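(* Let $G$ be a finite simple graph which is gap free and cricket free. Then the $4$-path ideal $I_4$ of $G$ has linear minimal free resolution.
   Context: Let $K$ be a field and $S$ the polynomial ring over $K$ whose variables are the vertices of $G$. The $4$-path ideal $I_4\subseteq S$ is generated by the monomials $x_1x_2x_3x_4$ with $x_1,\dots,x_4$ distinct vertices and $x_1x_2$, $x_2x_3$, $x_3x_4$ edges of $G$. $G$ is gap free if there are no two vertex-disjoint edges $uv$, $xy$ of $G$ such that $G$ has no edge with one endpoint in $\{u,v\}$ and the other in $\{x,y\}$ (equivalently, the complement $G^c$ has no induced $4$-cycle). A cricket is a graph isomorphic to the graph with vertices $w_1,w_2,w_3,w_4,w_5$ and edges $w_1w_3,\ w_2w_3,\ w_3w_4,\ w_3w_5,\ w_4w_5$; $G$ is cricket free if it has no induced subgraph that is a cricket. A monomial ideal $J$ generated in degree $d$ has linear minimal free resolution if $\operatorname{Tor}_i^S(J,K)_j=0$ for all $i\ge 1$ and all $j\neq i+d$ (here $d=4$; the condition is vacuous if $J=0$). *)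

theory Defs
  imports Main "HOL-Library.Poly_Mapping"
begin

section \<open>Graphs\<close>

definition simple_graph :: "'v set \<Rightarrow> 'v set set \<Rightarrow> bool" where
  "simple_graph V E \<longleftrightarrow> finite V \<and> (\<forall>e\<in>E. e \<subseteq> V \<and> card e = 2)"

definition gap_free :: "'v set set \<Rightarrow> bool" where
  "gap_free E \<longleftrightarrow>
     \<not> (\<exists>e\<in>E. \<exists>f\<in>E. e \<inter> f = {} \<and> (\<forall>a\<in>e. \<forall>b\<in>f. {a, b} \<notin> E))"

definition graph_isomorphic ::
    "'a set \<Rightarrow> 'a set set \<Rightarrow> 'b set \<Rightarrow> 'b set set \<Rightarrow> bool" where
  "graph_isomorphic V E V' E' \<longleftrightarrow>
     (\<exists>f. bij_betw f V V' \<and> (\<forall>u\<in>V. \<forall>v\<in>V. {u, v} \<in> E \<longleftrightarrow> {f u, f v} \<in> E'))"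

definition induced_edges :: "'v set set \<Rightarrow> 'v set \<Rightarrow> 'v set set" where
  "induced_edges E W = {e \<in> E. e \<subseteq> W}"

definition cricket_vertices :: "nat set" where
  "cricket_vertices = {1, 2, 3, 4, 5}"

definition cricket_edges :: "nat set set" where
  "cricket_edges = {{1, 3}, {2, 3}, {3, 4}, {3, 5}, {4, 5}}"

definition cricket_free :: "'v set \<Rightarrow> 'v set set \<Rightarrow> bool" where
  "cricket_free V E \<longleftrightarrow>
     \<not> (\<exists>W\<subseteq>V. graph_isomorphic cricket_vertices cricket_edges W (induced_edges E W))"

section \<open>The polynomial ring and the 4-path ideal\<close>

type_synonym ('v, 'k) mpoly = "('v \<Rightarrow>\<^sub>0 nat) \<Rightarrow>\<^sub>0 'k"

text \<open>The ring \<open>S = K[V]\<close> is a subset of the type of polynomials in all variables from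
  the type \<open>'v\<close>; ideals and free modules below are formed over this subset.\<close>

definition poly_ring :: "'v set \<Rightarrow> ('v, 'k::field) mpoly set" where
  "poly_ring V = {p. \<forall>m\<in>Poly_Mapping.keys p. Poly_Mapping.keys m \<subseteq> V}"

definition var :: "'v \<Rightarrow> ('v, 'k::field) mpoly" where
  "var v = Poly_Mapping.single (Poly_Mapping.single v 1) 1"

definition mdeg :: "('v \<Rightarrow>\<^sub>0 nat) \<Rightarrow> nat" where
  "mdeg m = (\<Sum>v\<in>Poly_Mapping.keys m. Poly_Mapping.lookup m v)"

definition homogeneous :: "int \<Rightarrow> ('v, 'k::field) mpoly \<Rightarrow> bool" where
  "homogeneous d p \<longleftrightarrow> (\<forall>m\<in>Poly_Mapping.keys p. int (mdeg m) = d)"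

definition ideal_generated ::
    "'v set \<Rightarrow> ('v, 'k::field) mpoly set \<Rightarrow> ('v, 'k) mpoly set" where
  "ideal_generated V B =
     {\<Sum>b\<in>T. q b * b |T q. finite T \<and> T \<subseteq> B \<and> (\<forall>b\<in>T. q b \<in> poly_ring V)}"

definition path_ideal4 :: "'v set \<Rightarrow> 'v set set \<Rightarrow> ('v, 'k::field) mpoly set" where
  "path_ideal4 V E = ideal_generated V
     {var x1 * var x2 * var x3 * var x4 |x1 x2 x3 x4.
        x1 \<in> V \<and> x2 \<in> V \<and> x3 \<in> V \<and> x4 \<in> V \<and> distinct [x1, x2, x3, x4] \<and>
        {x1, x2} \<in> E \<and> {x2, x3} \<in> E \<and> {x3, x4} \<in> E}"

definition monomial_ideal_in_degree ::
    "'v set \<Rightarrow> nat \<Rightarrow> ('v, 'k::field) mpoly set \<Rightarrow> bool" where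
  "monomial_ideal_in_degree V d J \<longleftrightarrow>
     (\<exists>M. (\<forall>m\<in>M. Poly_Mapping.keys m \<subseteq> V \<and> mdeg m = d) \<and>
          J = ideal_generated V ((\<lambda>m. Poly_Mapping.single m 1) ` M))"

section \<open>Graded free resolutions\<close>

text \<open>
  Data of a complex \<open>\<cdots> \<rightarrow> F\<^sub>2 \<rightarrow> F\<^sub>1 \<rightarrow> F\<^sub>0 \<rightarrow> J\<close> of finitely generated graded free
  \<open>S\<close>-modules.  The list \<open>gen_degs F i\<close> contains the degrees of the basis elements of \<open>F\<^sub>i\<close>,
  so \<open>F\<^sub>i\<close> is the direct sum of the shifts \<open>S(-a)\<close> for \<open>a\<close> in that list.  \<open>dmat F i\<close> is the matrix
  (row, column) of \<open>F\<^sub>i\<^sub>+\<^sub>1 \<rightarrow> F\<^sub>i\<close>, and \<open>aug F l\<close> is the image in \<open>J\<close> of the basis element \<open>l\<close> of \<open>F\<^sub>0\<close>.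
\<close>

record (overloaded) ('v, 'k) free_complex =
  gen_degs :: "nat \<Rightarrow> int list"
  dmat :: "nat \<Rightarrow> nat \<Rightarrow> nat \<Rightarrow> ('v, 'k) mpoly"
  aug :: "nat \<Rightarrow> ('v, 'k) mpoly"

definition free_rank :: "('v, 'k::field) free_complex \<Rightarrow> nat \<Rightarrow> nat" where
  "free_rank F i = length (gen_degs F i)"

definition free_module ::
    "'v set \<Rightarrow> ('v, 'k::field) free_complex \<Rightarrow> nat \<Rightarrow> (nat \<Rightarrow> ('v, 'k) mpoly) set" where
  "free_module V F i =
     {x. (\<forall>k<free_rank F i. x k \<in> poly_ring V) \<and> (\<forall>k\<ge>free_rank F i. x k = 0)}"

definition aug_map ::
    "('v, 'k::field) free_complex \<Rightarrow> (nat \<Rightarrow> ('v, 'k) mpoly) \<Rightarrow> ('v, 'k) mpoly" where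
  "aug_map F x = (\<Sum>l<free_rank F 0. aug F l * x l)"

definition diff_map ::
    "('v, 'k::field) free_complex \<Rightarrow> nat \<Rightarrow> (nat \<Rightarrow> ('v, 'k) mpoly) \<Rightarrow> (nat \<Rightarrow> ('v, 'k) mpoly)" where
  "diff_map F i x =
     (\<lambda>k. if k < free_rank F i then (\<Sum>l<free_rank F (Suc i). dmat F i k l * x l) else 0)"

definition graded_free_resolution ::
    "'v set \<Rightarrow> ('v, 'k::field) mpoly set \<Rightarrow> ('v, 'k) free_complex \<Rightarrow> bool" where
  "graded_free_resolution V J F \<longleftrightarrow>
     (\<forall>l<free_rank F 0. aug F l \<in> poly_ring V \<and> homogeneous (gen_degs F 0 ! l) (aug F l)) \<and>
     (\<forall>i. \<forall>k<free_rank F i. \<forall>l<free_rank F (Suc i).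
        dmat F i k l \<in> poly_ring V \<and>
        homogeneous (gen_degs F (Suc i) ! l - gen_degs F i ! k) (dmat F i k l)) \<and>
     aug_map F ` free_module V F 0 = J \<and>
     {x \<in> free_module V F 0. aug_map F x = 0} = diff_map F 0 ` free_module V F 1 \<and>
     (\<forall>i. {x \<in> free_module V F (Suc i). diff_map F i x = (\<lambda>k. 0)}
            = diff_map F (Suc i) ` free_module V F (Suc (Suc i)))"

section \<open>Graded Tor\<close>

text \<open>
  Tensoring with \<open>K = S/\<mm>\<close>, where \<open>\<mm>\<close> is generated by all variables, turns \<open>S(-a)\<close> into \<open>K\<close>
  placed in degree \<open>a\<close> and a matrix into the matrix of its constant terms.  Hence
  \<open>tensor_part F i j\<close> is \<open>(F\<^sub>i \<otimes> K)\<^sub>j\<close>, as coefficient vectors supported on the basis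
  elements of degree \<open>j\<close>, and \<open>tensor_diff F i\<close> is the induced map \<open>F\<^sub>i\<^sub>+\<^sub>1 \<otimes> K \<rightarrow> F\<^sub>i \<otimes> K\<close>.
\<close>

definition tensor_part ::
    "('v, 'k::field) free_complex \<Rightarrow> nat \<Rightarrow> int \<Rightarrow> (nat \<Rightarrow> 'k) set" where
  "tensor_part F i j = {c. \<forall>k. c k \<noteq> 0 \<longrightarrow> k < free_rank F i \<and> gen_degs F i ! k = j}"

definition tensor_diff ::
    "('v, 'k::field) free_complex \<Rightarrow> nat \<Rightarrow> (nat \<Rightarrow> 'k) \<Rightarrow> (nat \<Rightarrow> 'k)" where
  "tensor_diff F i c =
     (\<lambda>k. if k < free_rank F i
          then (\<Sum>l<free_rank F (Suc i). Poly_Mapping.lookup (dmat F i k l) 0 * c l) else 0)"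

definition tensor_cycles ::
    "('v, 'k::field) free_complex \<Rightarrow> nat \<Rightarrow> int \<Rightarrow> (nat \<Rightarrow> 'k) set" where
  "tensor_cycles F i j =
     {c \<in> tensor_part F i j. \<forall>i'. i = Suc i' \<longrightarrow> tensor_diff F i' c = (\<lambda>k. 0)}"

definition tensor_boundaries ::
    "('v, 'k::field) free_complex \<Rightarrow> nat \<Rightarrow> int \<Rightarrow> (nat \<Rightarrow> 'k) set" where
  "tensor_boundaries F i j = tensor_diff F i ` tensor_part F (Suc i) j"

definition tensor_homology ::
    "('v, 'k::field) free_complex \<Rightarrow> nat \<Rightarrow> int \<Rightarrow> (nat \<Rightarrow> 'k) set set" where
  "tensor_homology F i j = tensor_cycles F i j //
     {(c, c'). c \<in> tensor_cycles F i j \<and> c' \<in> tensor_cycles F i j \<and>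
               (\<lambda>k. c k - c' k) \<in> tensor_boundaries F i j}"

text \<open>
  \<open>Tor\<^sub>i(J, K)\<^sub>j\<close> as a set of cosets, computed from a chosen resolution.  A homogeneous ideal of
  \<open>K[V]\<close>, \<open>V\<close> finite, has a resolution as above since \<open>K[V]\<close> is Noetherian, and up to isomorphism
  the homology does not depend on the choice.
\<close>

definition graded_Tor ::
    "'v set \<Rightarrow> ('v, 'k::field) mpoly set \<Rightarrow> nat \<Rightarrow> int \<Rightarrow> (nat \<Rightarrow> 'k) set set" where
  "graded_Tor V J i j = tensor_homology (SOME F. graded_free_resolution V J F) i j"

text \<open>A quotient space is zero iff it has exactly one element.\<close>

definition has_linear_resolution ::
    "'v set \<Rightarrow> nat \<Rightarrow> ('v, 'k::field) mpoly set \<Rightarrow> bool" where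
  "has_linear_resolution V d J \<longleftrightarrow>
     monomial_ideal_in_degree V d J \<and>
     (\<forall>i\<ge>1. \<forall>j. j \<noteq> int (i + d) \<longrightarrow> is_singleton (graded_Tor V J i j))"

end

theory Submission
  imports Defs
begin

text \<open>
  The vertex sets of the 4-paths are ordered so that the ideal has linear quotients.  Pick a vertex
  \<open>x\<close> and take first the sets containing \<open>x\<close>, then those that avoid \<open>x\<close> but meet its neighbourhood
  \<open>N(x)\<close>, then those that avoid both.  A set of the second kind can exchange one vertex for \<open>x\<close>; one
  of the third kind can exchange a vertex for any element of \<open>N(x)\<close>, since by gap-freeness such an
  element is adjacent to an end of every edge of the path.  Iterating this on the second kind forces
  one to consider, for a set \<open>R\<close> of vertices already treated, only the paths that meet \<open>N(r)\<close> for
  every \<open>r \<in> R\<close>.  An exchange fails only if vertices of the path are the unique neighbours in it of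
  elements of \<open>R\<close>; gap- and cricket-freeness rule this out, provided that \<open>x\<close> has as many neighbours
  in \<open>R\<close> as possible.  The sets containing \<open>x\<close>, and then those containing \<open>x\<close> and a neighbour of it,
  are treated in the same way.

  Linear quotients give a resolution by linear forms: adding one generator extends the syzygy module
  by a colon ideal, which is generated by variables, and a horseshoe argument applies.  Any other
  graded resolution is homotopy equivalent to this one, so the graded Tor vanishes off the linear strand.
\<close>

section \<open>Families of sets with linear quotients\<close>

text \<open>The obstacle is a path all of whose four vertices are blocked, each by a private
  neighbour in \<open>R\<close>. A complete graph on four vertices with a pendant edge at each
  vertex is gap free and cricket free, so the path and its private neighbours alone give no
  contradiction. It comes from counting: no vertex is adjacent to two of the private neighbours,
  whereas an earlier set \<open>T\<close> has, besides the vertex to be inserted, only three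
  vertices with which to cover all four. Hence the exchange relies on the existence of an earlier
  set. Once \<open>x\<close> is fixed, only three or two vertices can leave, and the blocked
  configurations are contradictory by themselves; maximality is then measured on the elements of
  \<open>R\<close> that the fixed vertices leave uncovered. On the algebraic side, Tor is computed
  from a resolution of which nothing is known beyond its being one, hence the comparison. Modules
  are carried without degree shifts: every syzygy module has generators of degree 1, and shifts
  enter only when the resolution is assembled.\<close>

text \<open>The colon of the ideal of \<open>F\<close> by the monomial of \<open>W\<close> is
  generated by the monomials of \<open>T - W\<close>. The condition gives for each of them a
  variable \<open>t\<close> that divides it and lies in the colon itself, as
  \<open>insert t (W - {y})\<close> exceeds \<open>W\<close> by \<open>t\<close> alone. It also
  forces \<open>W\<close> to be new.\<close>

inductive linear_quotients :: "'a set set \<Rightarrow> bool" where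
  empty: "linear_quotients {}"
| insert: "linear_quotients F \<Longrightarrow> (\<And>T. T \<in> F \<Longrightarrow> \<exists>t\<in>T - W. \<exists>y\<in>W. insert t (W - {y}) \<in> F)
    \<Longrightarrow> linear_quotients (insert W F)"

text \<open>Exchanges inside \<open>B\<close> remain valid in the larger family, so only those from
  \<open>B\<close> into \<open>A\<close> need an assumption.\<close>

lemma linear_quotients_Un:
  assumes "linear_quotients B" and "linear_quotients A"
    and "\<And>W T. W \<in> B \<Longrightarrow> T \<in> A \<Longrightarrow> \<exists>t\<in>T - W. \<exists>y\<in>W. insert t (W - {y}) \<in> A"
  shows "linear_quotients (A \<union> B)"
  using assms
proof (induction)
  case (insert F W)
  have "linear_quotients (insert W (A \<union> F))"
  proof (rule linear_quotients.insert)
    show "linear_quotients (A \<union> F)"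
      using insert by blast
    fix T assume "T \<in> A \<union> F"
    then show "\<exists>t\<in>T - W. \<exists>y\<in>W. insert t (W - {y}) \<in> A \<union> F"
      using insert.hyps(2) insert.prems(2)[of W T] by blast
  qed
  then show ?case by simp
qed simp

lemma linear_quotients_cone:
  assumes "linear_quotients L" and "x \<notin> \<Union>L"
  shows "linear_quotients (insert x ` L)"
  using assms
proof (induction)
  case (insert F W)
  have "linear_quotients (insert (insert x W) (insert x ` F))"
  proof (rule linear_quotients.insert)
    show "linear_quotients (insert x ` F)" using insert by auto
    fix T assume "T \<in> insert x ` F"
    then obtain T' where T': "T' \<in> F" "T = insert x T'" by auto
    then obtain t y where ty: "t \<in> T' - W" "y \<in> W" "insert t (W - {y}) \<in> F"
      using insert.hyps(2) by blast
    have "x \<noteq> y" "x \<noteq> t" using ty T' insert.prems by auto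
    then have "insert t (insert x W - {y}) = insert x (insert t (W - {y}))" by auto
    then show "\<exists>t\<in>T - insert x W. \<exists>y\<in>insert x W. insert t (insert x W - {y}) \<in> insert x ` F"
      using ty T' \<open>x \<noteq> t\<close> by (metis DiffD1 DiffD2 DiffI image_eqI insertE insertI2)
  qed
  then show ?case by simp
qed (simp add: linear_quotients.empty)

text \<open>Every earlier \<open>T\<close> contains \<open>x\<close> and \<open>W\<close> does not,
  so \<open>x\<close> is the incoming vertex for all \<open>T\<close> at once and a single
  \<open>y\<close> suffices. With an empty \<open>L\<close> there is no \<open>T\<close> to
  serve.\<close>

lemma linear_quotients_shed:
  assumes L: "linear_quotients L" and D: "linear_quotients D"
    and x: "x \<notin> \<Union>L" "x \<notin> \<Union>D"
    and shed: "\<And>W. L \<noteq> {} \<Longrightarrow> W \<in> D \<Longrightarrow> \<exists>y\<in>W. W - {y} \<in> L"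
  shows "linear_quotients (insert x ` L \<union> D)"
proof (rule linear_quotients_Un[OF D linear_quotients_cone[OF L x(1)]])
  fix W T assume "W \<in> D" "T \<in> insert x ` L"
  then show "\<exists>t\<in>T - W. \<exists>y\<in>W. insert t (W - {y}) \<in> insert x ` L"
    using shed[of W] x(2) by blast
qed

lemma linear_quotients_singletons:
  assumes "finite F" and "\<And>f. f \<in> F \<Longrightarrow> card f = 1"
  shows "linear_quotients F"
  using assms
proof (induction)
  case (insert f F)
  show ?case
  proof (rule linear_quotients.insert)
    show "linear_quotients F" using insert by auto
    fix T assume T: "T \<in> F"
    obtain a b where "f = {a}" "T = {b}"
      using insert.prems T by (metis card_1_singletonE insertCI)
    then show "\<exists>t\<in>T - f. \<exists>y\<in>f. insert t (f - {y}) \<in> F"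
      using T insert.hyps(2) by auto
  qed
qed (rule linear_quotients.empty)

section \<open>Gap-free and cricket-free graphs\<close>

text \<open>In \<open>gap\<close>, two edges with a common vertex satisfy the conclusion
  automatically; in \<open>cricket\<close>, with centre \<open>w\<close>, triangle
  \<open>w p q\<close> and pendant vertices \<open>a\<close>, \<open>b\<close>, so does a
  coincidence of \<open>a\<close> or \<open>b\<close> with \<open>p\<close> or \<open>q\<close>.
  Hence \<open>a \<noteq> b\<close> is the only distinctness that is written.\<close>

locale gap_cricket_free_graph =
  fixes adj :: "'v \<Rightarrow> 'v \<Rightarrow> bool"
  assumes sym: "adj a b \<Longrightarrow> adj b a" and irr: "\<not> adj a a"
    and gap: "adj a b \<Longrightarrow> adj c d \<Longrightarrow> adj a c \<or> adj a d \<or> adj b c \<or> adj b d"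
    and cricket: "adj w p \<Longrightarrow> adj w q \<Longrightarrow> adj p q \<Longrightarrow> adj w a \<Longrightarrow> adj w b \<Longrightarrow> a \<noteq> b \<Longrightarrow>
      adj a b \<or> adj a p \<or> adj a q \<or> adj b p \<or> adj b q"
begin

lemma adj_commute: "adj a b \<longleftrightarrow> adj b a"
  using sym by blast

definition path4 :: "'v set \<Rightarrow> bool" where
  "path4 W \<longleftrightarrow> (\<exists>a b c d. distinct [a, b, c, d] \<and> W = {a, b, c, d} \<and> adj a b \<and> adj b c \<and> adj c d)"

text \<open>The twelve Hamiltonian paths on four vertices up to reversal, without quantifiers, so
  that exchanging a vertex becomes a propositional question for the SMT solver.\<close>

definition traceable :: "'v \<Rightarrow> 'v \<Rightarrow> 'v \<Rightarrow> 'v \<Rightarrow> bool" where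
  "traceable a b c d \<longleftrightarrow>
     adj a b \<and> adj b c \<and> adj c d \<or> adj a b \<and> adj b d \<and> adj d c \<or>
     adj a c \<and> adj c b \<and> adj b d \<or> adj a c \<and> adj c d \<and> adj d b \<or>
     adj a d \<and> adj d b \<and> adj b c \<or> adj a d \<and> adj d c \<and> adj c b \<or>
     adj b a \<and> adj a c \<and> adj c d \<or> adj b a \<and> adj a d \<and> adj d c \<or>
     adj b c \<and> adj c a \<and> adj a d \<or> adj b d \<and> adj d a \<and> adj a c \<or>
     adj c a \<and> adj a b \<and> adj b d \<or> adj c b \<and> adj b a \<and> adj a d"

lemma path4_iff:
  assumes "distinct [a, b, c, d]"
  shows "path4 {a, b, c, d} \<longleftrightarrow> traceable a b c d"
proof
  assume "path4 {a, b, c, d}"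
  then obtain p q r s where d: "distinct [p, q, r, s]" and e: "{a, b, c, d} = {p, q, r, s}"
    and adj: "adj p q" "adj q r" "adj r s"
    unfolding path4_def by blast
  have adj': "adj q p" "adj r q" "adj s r"
    using adj sym by blast+
  have "p \<in> {a, b, c, d}" "q \<in> {a, b, c, d}" "r \<in> {a, b, c, d}" "s \<in> {a, b, c, d}"
    using e by simp_all
  then show "traceable a b c d"
    using adj adj' d by (elim insertE emptyE) (simp_all add: traceable_def)
next
  have *: "path4 {p, q, r, s}" if "distinct [p, q, r, s]" "adj p q" "adj q r" "adj r s" for p q r s
    unfolding path4_def using that by blast
  assume "traceable a b c d"
  then show "path4 {a, b, c, d}"
    unfolding traceable_def
  proof (elim disjE conjE)
    assume "adj a b" "adj b c" "adj c d"
    then show ?thesis using *[of a b c d] assms by (auto simp: insert_commute)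
  next
    assume "adj a b" "adj b d" "adj d c"
    then show ?thesis using *[of a b d c] assms by (auto simp: insert_commute)
  next
    assume "adj a c" "adj c b" "adj b d"
    then show ?thesis using *[of a c b d] assms by (auto simp: insert_commute)
  next
    assume "adj a c" "adj c d" "adj d b"
    then show ?thesis using *[of a c d b] assms by (auto simp: insert_commute)
  next
    assume "adj a d" "adj d b" "adj b c"
    then show ?thesis using *[of a d b c] assms by (auto simp: insert_commute)
  next
    assume "adj a d" "adj d c" "adj c b"
    then show ?thesis using *[of a d c b] assms by (auto simp: insert_commute)
  next
    assume "adj b a" "adj a c" "adj c d"
    then show ?thesis using *[of b a c d] assms by (auto simp: insert_commute)
  next
    assume "adj b a" "adj a d" "adj d c"
    then show ?thesis using *[of b a d c] assms by (auto simp: insert_commute)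
  next
    assume "adj b c" "adj c a" "adj a d"
    then show ?thesis using *[of b c a d] assms by (auto simp: insert_commute)
  next
    assume "adj b d" "adj d a" "adj a c"
    then show ?thesis using *[of b d a c] assms by (auto simp: insert_commute)
  next
    assume "adj c a" "adj a b" "adj b d"
    then show ?thesis using *[of c a b d] assms by (auto simp: insert_commute)
  next
    assume "adj c b" "adj b a" "adj a d"
    then show ?thesis using *[of c b a d] assms by (auto simp: insert_commute)
  qed
qed

section \<open>Families of path completions\<close>

definition covers :: "'v set \<Rightarrow> 'v set \<Rightarrow> bool" where
  "covers W R \<longleftrightarrow> (\<forall>r\<in>R. \<exists>w\<in>W. adj r w)"

text \<open>An iterated link: \<open>S\<close> holds the vertices already fixed and only the
  remainder \<open>f\<close> is recorded. The shape is stable under splitting at a vertex, which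
  either moves into \<open>S\<close> or is dropped from \<open>Y\<close>.\<close>

definition paths :: "'v set \<Rightarrow> 'v set \<Rightarrow> 'v set \<Rightarrow> 'v set set" where
  "paths S Y R = {f. f \<subseteq> Y \<and> path4 (S \<union> f) \<and> covers (S \<union> f) R}"

lemma card_path4: "path4 W \<Longrightarrow> card W = 4"
  unfolding path4_def by auto

lemma finite_path4: "path4 W \<Longrightarrow> finite W"
  unfolding path4_def by auto

lemma finite_paths: "finite Y \<Longrightarrow> finite (paths S Y R)"
  unfolding paths_def by (rule finite_subset[of _ "Pow Y"]) auto

lemma paths_split:
  assumes "v \<in> Y"
  shows "paths S Y R = insert v ` paths (insert v S) (Y - {v}) R \<union> paths S (Y - {v}) R"
proof
  show "paths S Y R \<subseteq> insert v ` paths (insert v S) (Y - {v}) R \<union> paths S (Y - {v}) R"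
  proof
    fix f assume f: "f \<in> paths S Y R"
    show "f \<in> insert v ` paths (insert v S) (Y - {v}) R \<union> paths S (Y - {v}) R"
    proof (cases "v \<in> f")
      case True
      then have "insert v S \<union> (f - {v}) = S \<union> f" by auto
      then have "f - {v} \<in> paths (insert v S) (Y - {v}) R"
        using f unfolding paths_def by auto
      then show ?thesis using True by (auto simp: insert_absorb intro!: image_eqI[of _ _ "f - {v}"])
    next
      case False
      then show ?thesis using f unfolding paths_def by auto
    qed
  qed
  show "insert v ` paths (insert v S) (Y - {v}) R \<union> paths S (Y - {v}) R \<subseteq> paths S Y R"
    using assms unfolding paths_def by auto
qed

lemma card_paths:
  assumes "finite S" "S \<inter> Y = {}" "f \<in> paths S Y R"
  shows "card S + card f = 4"
proof -
  have "path4 (S \<union> f)" "S \<inter> f = {}" using assms(2,3) unfolding paths_def by auto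
  then show ?thesis
    using card_path4 finite_path4 by (metis card_Un_disjoint finite_Un)
qed

text \<open>The vertices \<open>ra\<close>, \<open>rb\<close>, \<open>rc\<close>, \<open>rd\<close> below witness that the corresponding vertex
  of the path cannot be exchanged for \<open>x\<close>; \<open>oa\<close>, \<open>ob\<close>, \<open>oc\<close>, \<open>od\<close> come from the maximality of \<open>x\<close>.\<close>

lemma local_shed:
  assumes "adj a b" "adj b c" "adj c d" "adj x a \<or> adj x b \<or> adj x c \<or> adj x d"
    "\<not> traceable x b c d \<or>
      adj ra a \<and> \<not> adj ra b \<and> \<not> adj ra c \<and> \<not> adj ra d \<and> \<not> adj ra x"
    "adj ra a \<Longrightarrow> \<not> adj ra x \<Longrightarrow> adj oa x \<and> \<not> adj oa a \<and> (adj oa b \<or> adj oa c \<or> adj oa d)"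
    "\<not> traceable x a c d \<or>
      adj rb b \<and> \<not> adj rb a \<and> \<not> adj rb c \<and> \<not> adj rb d \<and> \<not> adj rb x"
    "adj rb b \<Longrightarrow> \<not> adj rb x \<Longrightarrow> adj ob x \<and> \<not> adj ob b \<and> (adj ob a \<or> adj ob c \<or> adj ob d)"
    "\<not> traceable x a b d \<or>
      adj rc c \<and> \<not> adj rc a \<and> \<not> adj rc b \<and> \<not> adj rc d \<and> \<not> adj rc x"
    "adj rc c \<Longrightarrow> \<not> adj rc x \<Longrightarrow> adj oc x \<and> \<not> adj oc c \<and> (adj oc a \<or> adj oc b \<or> adj oc d)"
    "\<not> traceable x a b c \<or>
      adj rd d \<and> \<not> adj rd a \<and> \<not> adj rd b \<and> \<not> adj rd c \<and> \<not> adj rd x"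
    "adj rd d \<Longrightarrow> \<not> adj rd x \<Longrightarrow> adj od x \<and> \<not> adj od d \<and> (adj od a \<or> adj od b \<or> adj od c)"
  shows "(adj ra a \<and> \<not> adj ra b \<and> \<not> adj ra c \<and> \<not> adj ra d \<and> \<not> adj ra x) \<and>
    (adj rb b \<and> \<not> adj rb a \<and> \<not> adj rb c \<and> \<not> adj rb d \<and> \<not> adj rb x) \<and>
    (adj rc c \<and> \<not> adj rc a \<and> \<not> adj rc b \<and> \<not> adj rc d \<and> \<not> adj rc x) \<and>
    (adj rd d \<and> \<not> adj rd a \<and> \<not> adj rd b \<and> \<not> adj rd c \<and> \<not> adj rd x)"
  using assms unfolding traceable_def using gap cricket adj_commute irr by (smt (verit))

text \<open>Gap-freeness for \<open>x n\<close> and an edge of the path makes \<open>n\<close>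
  adjacent to an end of that edge, since \<open>x\<close> sees none of the path. This takes the
  place of maximality, so no vertices of the kind \<open>oa\<close> occur.\<close>

lemma local_shed_remote:
  assumes "adj a b" "adj b c" "adj c d"
    "adj x n" "\<not> adj x a" "\<not> adj x b" "\<not> adj x c" "\<not> adj x d"
    "\<not> traceable n b c d \<or>
      adj ra a \<and> \<not> adj ra b \<and> \<not> adj ra c \<and> \<not> adj ra d \<and> \<not> adj ra n"
    "\<not> traceable n a c d \<or>
      adj rb b \<and> \<not> adj rb a \<and> \<not> adj rb c \<and> \<not> adj rb d \<and> \<not> adj rb n"
    "\<not> traceable n a b d \<or>
      adj rc c \<and> \<not> adj rc a \<and> \<not> adj rc b \<and> \<not> adj rc d \<and> \<not> adj rc n"
    "\<not> traceable n a b c \<or>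
      adj rd d \<and> \<not> adj rd a \<and> \<not> adj rd b \<and> \<not> adj rd c \<and> \<not> adj rd n"
  shows "(adj ra a \<and> \<not> adj ra b \<and> \<not> adj ra c \<and> \<not> adj ra d \<and> \<not> adj ra n) \<and>
    (adj rb b \<and> \<not> adj rb a \<and> \<not> adj rb c \<and> \<not> adj rb d \<and> \<not> adj rb n) \<and>
    (adj rc c \<and> \<not> adj rc a \<and> \<not> adj rc b \<and> \<not> adj rc d \<and> \<not> adj rc n) \<and>
    (adj rd d \<and> \<not> adj rd a \<and> \<not> adj rd b \<and> \<not> adj rd c \<and> \<not> adj rd n)"
  using assms unfolding traceable_def using gap cricket adj_commute irr by (smt (verit))

text \<open>In the case where the path spans a complete graph: two adjacent private neighbours would
  form a gap with the edge joining the other two path vertices, so private neighbours are pairwise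
  non-adjacent. A common neighbour \<open>e\<close> of two of them then becomes, by gap-freeness,
  the centre of a cricket whose pendant vertices are private neighbours.\<close>

lemma rigid_path_aux:
  assumes "adj a b" "adj b c" "adj c d"
    "adj ra a" "\<not> adj ra b" "\<not> adj ra c" "\<not> adj ra d"
    "adj rb b" "\<not> adj rb a" "\<not> adj rb c" "\<not> adj rb d"
    "adj rc c" "\<not> adj rc a" "\<not> adj rc b" "\<not> adj rc d"
    "adj rd d" "\<not> adj rd a" "\<not> adj rd b" "\<not> adj rd c"
  shows "\<not> (adj ra e \<and> adj rb e)" "\<not> (adj ra e \<and> adj rc e)" "\<not> (adj ra e \<and> adj rd e)"
    "\<not> (adj rb e \<and> adj rc e)" "\<not> (adj rb e \<and> adj rd e)" "\<not> (adj rc e \<and> adj rd e)"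
  using assms gap cricket adj_commute irr by (smt (verit))+

text \<open>The vertex \<open>x\<close> is fixed, its neighbour \<open>c\<close> is to enter, and
  one of \<open>p\<close>, \<open>q\<close>, \<open>d\<close> is to leave. The clauses on
  \<open>op\<close>, \<open>oq\<close>, \<open>od\<close> are conditional on adjacency to
  \<open>x\<close> because \<open>c\<close> is maximal only among the neighbours of
  \<open>x\<close>.\<close>

lemma local_shed_link:
  assumes "traceable x p q d" "adj x c"
    "\<not> traceable x c q d \<or> adj rp p \<and> \<not> adj rp q \<and> \<not> adj rp d \<and> \<not> adj rp x \<and> \<not> adj rp c"
    "\<not> traceable x c p d \<or> adj rq q \<and> \<not> adj rq p \<and> \<not> adj rq d \<and> \<not> adj rq x \<and> \<not> adj rq c"
    "\<not> traceable x c p q \<or> adj rd d \<and> \<not> adj rd p \<and> \<not> adj rd q \<and> \<not> adj rd x \<and> \<not> adj rd c"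
    "adj x p \<Longrightarrow> adj rp p \<Longrightarrow> \<not> adj rp x \<Longrightarrow> \<not> adj rp c \<Longrightarrow>
       adj op c \<and> \<not> adj op x \<and> \<not> adj op p \<and> (adj op q \<or> adj op d)"
    "adj x q \<Longrightarrow> adj rq q \<Longrightarrow> \<not> adj rq x \<Longrightarrow> \<not> adj rq c \<Longrightarrow>
       adj oq c \<and> \<not> adj oq x \<and> \<not> adj oq q \<and> (adj oq p \<or> adj oq d)"
    "adj x d \<Longrightarrow> adj rd d \<Longrightarrow> \<not> adj rd x \<Longrightarrow> \<not> adj rd c \<Longrightarrow>
       adj od c \<and> \<not> adj od x \<and> \<not> adj od d \<and> (adj od p \<or> adj od q)"
  shows False
  using assms unfolding traceable_def using gap cricket adj_commute irr by (smt (verit))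

text \<open>Here \<open>k\<close> hangs on \<open>q\<close>. Gap-freeness for \<open>q k\<close> and
  \<open>v l\<close> gives \<open>adj q v\<close> or \<open>adj k l\<close>; the first makes
  \<open>x c v q\<close> traceable, the second is a gap with \<open>x c\<close>.\<close>

lemma local_shed_pair_far:
  assumes "adj x c" "traceable x c q k" "\<not> adj k x" "\<not> adj k c" "\<not> adj l x" "\<not> adj l c"
    "adj x v \<or> adj c v" "\<not> traceable x c v q" "\<not> adj k v" "adj l v" "\<not> adj l q"
  shows False
  using assms unfolding traceable_def using gap cricket adj_commute irr by (smt (verit))

text \<open>Vertices adjacent to neither \<open>x\<close> nor \<open>c\<close> are pairwise
  non-adjacent, since \<open>x c\<close> is an edge. Gap-freeness for \<open>r w\<close> with
  \<open>s v\<close> and with \<open>s q\<close> thus makes \<open>w\<close> adjacent to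
  \<open>v\<close> and \<open>q\<close>, so \<open>x c v w\<close> is traceable; then
  \<open>t q\<close> with \<open>u v\<close> gives \<open>adj q v\<close>. If \<open>v\<close> sees
  both \<open>x\<close> and \<open>c\<close>, it is the centre of a cricket with pendant vertices
  \<open>s\<close>, \<open>u\<close>; otherwise a cricket is centred at \<open>w\<close> or
  \<open>q\<close>.\<close>

lemma local_shed_pair_aux:
  assumes "adj x c" "traceable x c q w" "v \<noteq> q" "v \<noteq> w" "q \<noteq> w"
    "adj x v \<or> adj c v" "adj x q \<or> adj c q" "adj x w \<or> adj c w" "traceable x c v q"
    "\<not> adj r x \<and> \<not> adj r c \<and> \<not> adj r v \<and> \<not> adj r q \<and> adj r w \<and>
      \<not> adj s x \<and> \<not> adj s c \<and> adj s v \<and> \<not> adj s w \<and> adj s q"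
    "\<not> traceable x c v w \<or> \<not> adj t x \<and> \<not> adj t c \<and> \<not> adj t v \<and> \<not> adj t w \<and> adj t q \<and>
      \<not> adj u x \<and> \<not> adj u c \<and> adj u v \<and> \<not> adj u q \<and> adj u w"
  shows False
  using assms unfolding traceable_def using gap cricket adj_commute irr by (smt (verit))

lemma local_shed_pair:
  assumes "adj x c" "traceable x c q w" "v \<noteq> q" "v \<noteq> w" "q \<noteq> w"
    "adj x v \<or> adj c v" "adj x q \<or> adj c q" "adj x w \<or> adj c w"
    "\<not> traceable x c v q \<or> \<not> adj r x \<and> \<not> adj r c \<and> \<not> adj r v \<and> \<not> adj r q \<and> adj r w \<and>
      \<not> adj s x \<and> \<not> adj s c \<and> adj s v \<and> \<not> adj s w \<and> adj s q"
    "\<not> traceable x c v w \<or> \<not> adj t x \<and> \<not> adj t c \<and> \<not> adj t v \<and> \<not> adj t w \<and> adj t q \<and>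
      \<not> adj u x \<and> \<not> adj u c \<and> adj u v \<and> \<not> adj u q \<and> adj u w"
    "v \<noteq> x" "v \<noteq> c"
  shows False
proof -
  have swap: "traceable x c w q"
    using assms(2) adj_commute unfolding traceable_def by (smt (verit))
  consider "traceable x c v q" | "\<not> traceable x c v q" "traceable x c v w"
    | "\<not> traceable x c v q" "\<not> traceable x c v w" by blast
  then show ?thesis
  proof cases
    case 1
    show ?thesis
      by (rule local_shed_pair_aux[OF assms(1-8) 1 _ assms(10)]) (use 1 assms(9) in simp)
  next
    case 2
    show ?thesis
      by (rule local_shed_pair_aux[OF assms(1) swap assms(4,3) assms(5)[symmetric] assms(6,8,7) 2(2) _ assms(9)])
        (use 2 assms(10) in simp)
  next
    \<comment> \<open>Now \<open>v\<close>, \<open>q\<close> and \<open>w\<close> are attached to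
      the same one of \<open>x\<close>, \<open>c\<close> and \<open>v\<close> sees neither
      \<open>q\<close> nor \<open>w\<close>, so the path must use the edge \<open>q w\<close>. The
      common attachment vertex is then the centre of a cricket with pendant vertices
      \<open>v\<close> and the other one of \<open>x\<close>, \<open>c\<close>.\<close>
    case 3
    have no: "\<not> (adj v x \<and> adj x c \<and> adj c u)" "\<not> (adj v c \<and> adj c x \<and> adj x u)"
        "\<not> (adj c x \<and> adj x v \<and> adj v u)" "\<not> (adj x c \<and> adj c v \<and> adj v u)"
      if "\<not> traceable x c v u" for u
      using that unfolding traceable_def by simp_all
    have qw: "adj q w"
      using swap assms(1,3-8) no[OF 3(1)] no[OF 3(2)] adj_commute unfolding traceable_def by (smt (verit))
    show ?thesis
      using assms(1,3-8,11,12) no[OF 3(1)] no[OF 3(2)] qw cricket[of x q w c v] cricket[of c q w x v]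
        adj_commute[of x] adj_commute[of c] adj_commute[of v] irr by (smt (verit))
  qed
qed

end

section \<open>Linear quotients of the path families\<close>

lemma finite_has_max:
  fixes f :: "'a \<Rightarrow> nat"
  assumes "finite A" "A \<noteq> {}"
  shows "\<exists>v\<in>A. \<forall>q\<in>A. f q \<le> f v"
proof -
  have "Max (f ` A) \<in> f ` A" using assms by (intro Max_in) auto
  then obtain v where "v \<in> A" "f v = Max (f ` A)" by auto
  then show ?thesis using assms by (intro bexI[of _ v]) auto
qed

text \<open>The form in which maximality is used: if a rival \<open>A\<close> has a neighbour that
  the maximal \<open>A'\<close> lacks, then by counting \<open>A'\<close> has one that
  \<open>A\<close> lacks.\<close>

lemma card_Int_exchange:
  assumes "finite B" "card (A \<inter> B) \<le> card (A' \<inter> B)" "e \<in> A" "e \<in> B" "e \<notin> A'"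
  shows "\<exists>e'. e' \<in> A' \<and> e' \<in> B \<and> e' \<notin> A"
proof (rule ccontr)
  assume "\<not> ?thesis"
  then have "A' \<inter> B \<subset> A \<inter> B" using assms by blast
  then show False using assms(1,2) psubset_card_mono[of "A \<inter> B" "A' \<inter> B"] by auto
qed

context gap_cricket_free_graph
begin

lemma paths_pairE:
  assumes "f \<in> paths {x, c} Y R" "x \<noteq> c" "x \<notin> Y" "c \<notin> Y"
  obtains q w where "f = {q, w}" "distinct [x, c, q, w]" "q \<in> Y" "w \<in> Y" "traceable x c q w"
    "\<And>r. r \<in> R \<Longrightarrow> \<not> adj r x \<Longrightarrow> \<not> adj r c \<Longrightarrow> adj r q \<or> adj r w"
proof -
  have "card f = 2" using card_paths[OF _ _ assms(1)] assms by auto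
  then obtain q w where f: "f = {q, w}" "q \<noteq> w" by (meson card_2_iff)
  have Y: "q \<in> Y" "w \<in> Y" and p: "path4 {x, c, q, w}" and cov: "covers {x, c, q, w} R"
    using assms(1) f unfolding paths_def by auto
  have d: "distinct [x, c, q, w]" using Y f assms by auto
  show ?thesis
    using that[OF f(1) d Y] p cov path4_iff[OF d] unfolding covers_def by blast
qed

lemma paths_tripleE:
  assumes "f \<in> paths {x} Y R" "x \<notin> Y"
  obtains p q d where "f = {p, q, d}" "distinct [x, p, q, d]" "p \<in> Y" "q \<in> Y" "d \<in> Y" "traceable x p q d"
    "\<And>r. r \<in> R \<Longrightarrow> \<not> adj r x \<Longrightarrow> adj r p \<or> adj r q \<or> adj r d"
proof -
  have "card f = 3" using card_paths[OF _ _ assms(1)] assms by auto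
  then obtain p q d where f: "f = {p, q, d}" "p \<noteq> q" "q \<noteq> d" "p \<noteq> d" by (metis card_3_iff)
  have Y: "p \<in> Y" "q \<in> Y" "d \<in> Y" and p: "path4 {x, p, q, d}" and cov: "covers {x, p, q, d} R"
    using assms(1) f unfolding paths_def by auto
  have d: "distinct [x, p, q, d]" using Y f assms by auto
  show ?thesis
    using that[OF f(1) d Y] p cov path4_iff[OF d] unfolding covers_def by blast
qed

lemma path4E:
  assumes "path4 W"
  obtains a b c d where "distinct [a, b, c, d]" "W = {a, b, c, d}" "adj a b" "adj b c" "adj c d"
  using assms unfolding path4_def by blast

lemma linear_quotients_pairs:
  assumes "finite Y" "finite R" "adj x c" "x \<notin> Y" "c \<notin> Y"
  shows "linear_quotients (paths {x, c} Y R)"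
  using assms
proof (induction "card Y" arbitrary: Y rule: less_induct)
  case less
  have xc: "x \<noteq> c" using less.prems irr by auto
  define Q where "Q = {v \<in> Y. adj x v \<or> adj c v}"
  define K where "K = Y - Q"
  define R' where "R' = {r \<in> R. \<not> adj r x \<and> \<not> adj r c}"
  have fin: "finite Q" "finite K" "finite R'" using less.prems unfolding Q_def K_def R'_def by auto
  show ?case
  proof (cases "Q = {}")
    case True
    have "paths {x, c} Y R = {}"
    proof (rule ccontr)
      assume "paths {x, c} Y R \<noteq> {}"
      then obtain f where "f \<in> paths {x, c} Y R" by auto
      from paths_pairE[OF this xc less.prems(4,5)] obtain q w where
        "q \<in> Y" "w \<in> Y" "traceable x c q w" by metis
      then show False using True unfolding Q_def traceable_def by (auto simp: adj_commute)
    qed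
    then show ?thesis by (simp add: linear_quotients.empty)
  next
    case False
    \<comment> \<open>The choice of \<open>v\<close> has two levels: most neighbours in
      \<open>R'\<close>, the part of \<open>R\<close> not covered by the edge \<open>x c\<close>,
      and among those most neighbours in \<open>K\<close>. The second level yields the vertex
      \<open>l\<close> required when one vertex of the pair lies in \<open>K\<close>.\<close>
    define Q1 where "Q1 = {v \<in> Q. \<forall>q\<in>Q. card (Collect (adj q) \<inter> R') \<le> card (Collect (adj v) \<inter> R')}"
    have "finite Q1" "Q1 \<noteq> {}"
      using fin finite_has_max[OF fin(1) False, of "\<lambda>v. card (Collect (adj v) \<inter> R')"] unfolding Q1_def by auto
    from finite_has_max[OF this, of "\<lambda>v. card (Collect (adj v) \<inter> K)"]
    obtain v where v: "v \<in> Q1" and vK: "\<And>q. q \<in> Q1 \<Longrightarrow> card (Collect (adj q) \<inter> K) \<le> card (Collect (adj v) \<inter> K)"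
      by blast
    have vQ: "v \<in> Q" "v \<in> Y" "adj x v \<or> adj c v" using v unfolding Q1_def Q_def by auto
    have vR: "card (Collect (adj q) \<inter> R') \<le> card (Collect (adj v) \<inter> R')" if "q \<in> Q" for q
      using v that unfolding Q1_def by auto
    have exch: "\<exists>s. s \<in> R' \<and> adj v s \<and> \<not> adj q s" if "q \<in> Q" "r \<in> R'" "adj q r" "\<not> adj v r" for q r
      using card_Int_exchange[OF fin(3) vR[OF that(1)], of r] that by blast
    have shed: "\<exists>y\<in>W. W - {y} \<in> paths (insert v {x, c}) (Y - {v}) R"
      if W: "W \<in> paths {x, c} (Y - {v}) R" for W
    proof -
      from paths_pairE[OF W xc] less.prems obtain q w where
        qw: "W = {q, w}" "distinct [x, c, q, w]" "q \<in> Y - {v}" "w \<in> Y - {v}" "traceable x c q w"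
        and cov: "\<And>r. r \<in> R \<Longrightarrow> \<not> adj r x \<Longrightarrow> \<not> adj r c \<Longrightarrow> adj r q \<or> adj r w" by blast
      have single: "{u} \<in> paths (insert v {x, c}) (Y - {v}) R"
        if "u \<in> Y - {v}" "traceable x c v u" "\<And>r. r \<in> R' \<Longrightarrow> adj r v \<or> adj r u" for u
      proof -
        have "distinct [x, c, v, u]" using xc less.prems vQ that by auto
        then have "path4 {x, c, v, u}" using path4_iff that by blast
        moreover have "covers {x, c, v, u} R" using that(3) unfolding covers_def R'_def by blast
        ultimately show ?thesis using that unfolding paths_def by (auto simp: insert_commute)
      qed
      have main: "\<exists>y\<in>W. W - {y} \<in> paths (insert v {x, c}) (Y - {v}) R"
        if "traceable x c v u" "\<And>r. r \<in> R' \<Longrightarrow> adj r v \<or> adj r u" "u = q \<or> u = w" for u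
        using that(3)
      proof
        assume "u = q"
        moreover have "{q, w} - {w} = {q}" using qw(2) by auto
        ultimately show ?thesis using single[of u] that qw by (metis insertI1 insertI2)
      next
        assume "u = w"
        moreover have "{q, w} - {q} = {w}" using qw(2) by auto
        ultimately show ?thesis using single[of u] that qw by (metis insertI1)
      qed
      \<comment> \<open>A vertex \<open>k\<close> in \<open>K\<close> sees no element of
        \<open>R'\<close>, by gap-freeness with \<open>x c\<close>. Hence \<open>q'\<close> covers
        all of \<open>R'\<close>, so does \<open>v\<close> by maximality, and \<open>q'\<close> ties
        with \<open>v\<close> at the first level. Covering is no obstacle any more; only the
        existence of a path is at stake, and there the second level decides.\<close>
      have far: thesis if qk: "{q, w} = {q', k}" "q' \<in> Q" "k \<in> K" and tr: "traceable x c q' k"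
        and W': "\<And>u. u = q' \<or> u = k \<Longrightarrow> traceable x c v u \<Longrightarrow> (\<And>r. r \<in> R' \<Longrightarrow> adj r v \<or> adj r u) \<Longrightarrow> thesis"
        for q' k thesis
      proof -
        have k: "\<not> adj k x" "\<not> adj k c" "k \<in> Y" using qk(3) unfolding K_def Q_def by (auto simp: adj_commute)
        have full: "adj q' r" if "r \<in> R'" for r
        proof -
          have "\<not> adj r k" using gap[of r k x c] that less.prems(3) k unfolding R'_def by (auto simp: adj_commute)
          moreover have "adj r q \<or> adj r w" using cov that unfolding R'_def by blast
          ultimately show ?thesis using qk(1) by (metis adj_commute doubleton_eq_iff)
        qed
        have vfull: "adj v r" if "r \<in> R'" for r
          using exch[OF qk(2) that full[OF that]] full by blast
        have cards: "Collect (adj q') \<inter> R' = R'" "Collect (adj v) \<inter> R' = R'" using full vfull by auto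
        have "q' \<in> Q1" using qk(2) vR unfolding Q1_def cards by (auto simp: cards)
        show thesis
        proof (cases "traceable x c v k")
          case True
          then show ?thesis using W'[of k] vfull sym by blast
        next
          case False
          show ?thesis
          proof (cases "traceable x c v q'")
            case True
            then show ?thesis using W'[of q'] vfull sym by blast
          next
            case nq: False
            have vk: "\<not> adj k v"
              using False vQ(3) less.prems(3) adj_commute unfolding traceable_def by (smt (verit))
            have "adj q' k" using tr k adj_commute unfolding traceable_def by (smt (verit))
            then obtain l where l: "adj v l" "l \<in> K" "\<not> adj q' l"
              using card_Int_exchange[OF fin(2) vK[OF \<open>q' \<in> Q1\<close>], of k] vk qk(3) sym by auto
            have "\<not> adj l x" "\<not> adj l c" using l(2) unfolding K_def Q_def by (auto simp: adj_commute)
            then show ?thesis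
              using local_shed_pair_far[OF less.prems(3) tr k(1,2) _ _ vQ(3) nq vk, of l] l by (simp add: adj_commute)
          qed
        qed
      qed
      have swap: "traceable x c w q"
        using qw(5) adj_commute unfolding traceable_def by (smt (verit))
      consider "q \<in> Q" "w \<in> Q" | "q \<in> Q" "w \<in> K" | "w \<in> Q" "q \<in> K" | "q \<in> K" "w \<in> K"
        using qw unfolding K_def by blast
      then show ?thesis
      proof cases
        case 1
        show ?thesis
        proof (rule ccontr)
          assume no: "\<not> ?thesis"
          \<comment> \<open>Here \<open>r\<close> is left uncovered when \<open>v\<close> replaces
            \<open>w\<close>, and \<open>s\<close> is what the maximality of \<open>v\<close>
            returns in exchange for \<open>r\<close>.\<close>
          have "\<exists>r s. \<not> traceable x c v q \<or> \<not> adj r x \<and> \<not> adj r c \<and> \<not> adj r v \<and> \<not> adj r q \<and> adj r w \<and>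
              \<not> adj s x \<and> \<not> adj s c \<and> adj s v \<and> \<not> adj s w \<and> adj s q"
          proof (cases "traceable x c v q")
            case True
            then obtain r where r: "r \<in> R'" "\<not> adj r v" "\<not> adj r q" using no main[of q] by blast
            then have rw: "adj r w" using cov unfolding R'_def by blast
            then obtain s where s: "s \<in> R'" "adj v s" "\<not> adj w s"
              using exch[OF 1(2) r(1)] r by (auto simp: adj_commute)
            then have "adj s q" using cov[of s] unfolding R'_def by (auto simp: adj_commute)
            then show ?thesis
              using r rw s sym[OF s(2)] adj_commute[of w s] adj_commute[of q s]
              by (intro exI[of _ r] exI[of _ s]) (simp add: R'_def)
          qed auto
          moreover have "\<exists>t u. \<not> traceable x c v w \<or> \<not> adj t x \<and> \<not> adj t c \<and> \<not> adj t v \<and> \<not> adj t w \<and> adj t q \<and>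
              \<not> adj u x \<and> \<not> adj u c \<and> adj u v \<and> \<not> adj u q \<and> adj u w"
          proof (cases "traceable x c v w")
            case True
            then obtain r where r: "r \<in> R'" "\<not> adj r v" "\<not> adj r w" using no main[of w] by blast
            then have rw: "adj r q" using cov unfolding R'_def by blast
            then obtain s where s: "s \<in> R'" "adj v s" "\<not> adj q s"
              using exch[OF 1(1) r(1)] r by (auto simp: adj_commute)
            then have "adj s w" using cov[of s] unfolding R'_def by (auto simp: adj_commute)
            then show ?thesis
              using r rw s sym[OF s(2)] adj_commute[of w s] adj_commute[of q s]
              by (intro exI[of _ r] exI[of _ s]) (simp add: R'_def)
          qed auto
          ultimately obtain r s t u where
            "\<not> traceable x c v q \<or> \<not> adj r x \<and> \<not> adj r c \<and> \<not> adj r v \<and> \<not> adj r q \<and> adj r w \<and>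
              \<not> adj s x \<and> \<not> adj s c \<and> adj s v \<and> \<not> adj s w \<and> adj s q"
            "\<not> traceable x c v w \<or> \<not> adj t x \<and> \<not> adj t c \<and> \<not> adj t v \<and> \<not> adj t w \<and> adj t q \<and>
              \<not> adj u x \<and> \<not> adj u c \<and> adj u v \<and> \<not> adj u q \<and> adj u w"
            by (elim exE)
          then show False
            by (rule local_shed_pair[OF less.prems(3) qw(5) _ _ _ vQ(3), rotated 5])
              (use qw 1 vQ less.prems in \<open>auto simp: Q_def\<close>)
        qed
      next
        case 2
        show ?thesis by (rule far[OF refl 2 qw(5)]) (use main in blast)
      next
        case 3
        show ?thesis by (rule far[OF insert_commute 3 swap]) (use main in blast)
      next
        case 4
        then have "\<not> adj q x" "\<not> adj q c" "\<not> adj w x" "\<not> adj w c"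
          unfolding K_def Q_def using qw by (auto simp: adj_commute)
        then show ?thesis using qw(5) adj_commute unfolding traceable_def by (smt (verit))
      qed
    qed
    have "linear_quotients (insert v ` paths (insert v {x, c}) (Y - {v}) R \<union> paths {x, c} (Y - {v}) R)"
    proof (rule linear_quotients_shed)
      have "card f = 1" if "f \<in> paths (insert v {x, c}) (Y - {v}) R" for f
        using card_paths[OF _ _ that] less.prems vQ xc by (auto simp: card_insert_if split: if_splits)
      then show "linear_quotients (paths (insert v {x, c}) (Y - {v}) R)"
        using linear_quotients_singletons[OF finite_paths] less.prems by blast
      show "linear_quotients (paths {x, c} (Y - {v}) R)"
        using less.hyps[OF card_Diff1_less[OF less.prems(1) vQ(2)]] less.prems by simp
    qed (use shed in \<open>auto simp: paths_def\<close>)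
    then show ?thesis using paths_split[OF vQ(2)] by simp
  qed
qed


lemma linear_quotients_triples:
  assumes "finite Y" "finite R" "x \<notin> Y"
  shows "linear_quotients (paths {x} Y R)"
  using assms
proof (induction "card Y" arbitrary: Y rule: less_induct)
  case less
  define N where "N = {c \<in> Y. adj x c}"
  define R' where "R' = {r \<in> R. \<not> adj r x}"
  have fin: "finite N" "finite R'" using less.prems unfolding N_def R'_def by auto
  show ?case
  proof (cases "N = {}")
    case True
    have "paths {x} Y R = {}"
    proof (rule ccontr)
      assume "paths {x} Y R \<noteq> {}"
      then obtain f where "f \<in> paths {x} Y R" by auto
      from paths_tripleE[OF this less.prems(3)] obtain p q d where
        "p \<in> Y" "q \<in> Y" "d \<in> Y" "traceable x p q d" by metis
      then show False using True unfolding N_def traceable_def by (auto simp: adj_commute)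
    qed
    then show ?thesis by (simp add: linear_quotients.empty)
  next
    case False
    \<comment> \<open>Any neighbour of \<open>x\<close> in \<open>Y\<close> would lead to the case
      of a fixed edge; the one covering most of what \<open>x\<close> leaves uncovered in
      \<open>R\<close> is taken, so that a failed exchange has a counterpart.\<close>
    from finite_has_max[OF fin(1) this, of "\<lambda>v. card (Collect (adj v) \<inter> R')"]
    obtain c where c: "c \<in> N"
      and cR: "\<And>q. q \<in> N \<Longrightarrow> card (Collect (adj q) \<inter> R') \<le> card (Collect (adj c) \<inter> R')" by blast
    have cY: "c \<in> Y" "adj x c" "x \<noteq> c" using c less.prems unfolding N_def by auto
    have shed: "\<exists>y\<in>W. W - {y} \<in> paths (insert c {x}) (Y - {c}) R"
      if W: "W \<in> paths {x} (Y - {c}) R" for W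
    proof (rule ccontr)
      assume no: "\<not> ?thesis"
      from paths_tripleE[OF W] less.prems obtain p q d where
        T: "W = {p, q, d}" "distinct [x, p, q, d]" "p \<in> Y - {c}" "q \<in> Y - {c}" "d \<in> Y - {c}"
          "traceable x p q d"
        and cov: "\<And>r. r \<in> R \<Longrightarrow> \<not> adj r x \<Longrightarrow> adj r p \<or> adj r q \<or> adj r d" by blast
      have blocked: "\<exists>r e. (\<not> traceable x c u1 u2 \<or> adj r u \<and> \<not> adj r u1 \<and> \<not> adj r u2 \<and> \<not> adj r x \<and> \<not> adj r c) \<and>
          (adj x u \<longrightarrow> adj r u \<longrightarrow> \<not> adj r x \<longrightarrow> \<not> adj r c \<longrightarrow>
            adj e c \<and> \<not> adj e x \<and> \<not> adj e u \<and> (adj e u1 \<or> adj e u2))"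
        if u: "W = {u, u1, u2}" "u \<noteq> u1" "u \<noteq> u2" "u1 \<noteq> u2" for u u1 u2
      proof (cases "traceable x c u1 u2")
        case False
        \<comment> \<open>Placeholder witnesses: \<open>u\<close> is not adjacent to itself, which
          makes the second clause vacuous, and \<open>x\<close> is arbitrary.\<close>
        then show ?thesis using irr[of u] by (intro exI[of _ u] exI[of _ x]) simp_all
      next
        case True
        have mem: "u \<in> Y - {c}" "u1 \<in> Y - {c}" "u2 \<in> Y - {c}" using W u(1) unfolding paths_def by auto
        have "distinct [x, c, u1, u2]" using mem u cY less.prems by auto
        then have "path4 {x, c, u1, u2}" using path4_iff True by blast
        moreover have "W - {u} = {u1, u2}" using u by auto
        ultimately have "\<not> covers {x, c, u1, u2} R"
          using no u(1) mem unfolding paths_def by (auto simp: insert_commute)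
        then obtain r where r: "r \<in> R" "\<not> adj r x" "\<not> adj r c" "\<not> adj r u1" "\<not> adj r u2"
          unfolding covers_def by blast
        have covW: "adj r u \<or> adj r u1 \<or> adj r u2" if "r \<in> R" "\<not> adj r x" for r
          using cov[OF that] u(1) T(1) by (metis insertE insertI1 insertI2 singletonD)
        have ru: "adj r u" using covW r by blast
        have "\<exists>e. adj e c \<and> \<not> adj e x \<and> \<not> adj e u \<and> (adj e u1 \<or> adj e u2)" if "adj x u"
        proof -
          have "u \<in> N" using that mem unfolding N_def by auto
          then obtain e where "adj c e" "e \<in> R'" "\<not> adj u e"
            using card_Int_exchange[OF fin(2) cR, of u r] r ru sym unfolding R'_def by auto
          then show ?thesis using covW[of e] sym unfolding R'_def by blast
        qed
        then show ?thesis using ru r by blast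
      qed
      have ne: "p \<noteq> q" "q \<noteq> d" "p \<noteq> d" using T by auto
      obtain rp op where p:
        "\<not> traceable x c q d \<or> adj rp p \<and> \<not> adj rp q \<and> \<not> adj rp d \<and> \<not> adj rp x \<and> \<not> adj rp c"
        "adj x p \<Longrightarrow> adj rp p \<Longrightarrow> \<not> adj rp x \<Longrightarrow> \<not> adj rp c \<Longrightarrow>
          adj op c \<and> \<not> adj op x \<and> \<not> adj op p \<and> (adj op q \<or> adj op d)"
        using blocked[of p q d] T(1) ne by (auto simp: insert_commute)
      obtain rq oq where q:
        "\<not> traceable x c p d \<or> adj rq q \<and> \<not> adj rq p \<and> \<not> adj rq d \<and> \<not> adj rq x \<and> \<not> adj rq c"
        "adj x q \<Longrightarrow> adj rq q \<Longrightarrow> \<not> adj rq x \<Longrightarrow> \<not> adj rq c \<Longrightarrow>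
          adj oq c \<and> \<not> adj oq x \<and> \<not> adj oq q \<and> (adj oq p \<or> adj oq d)"
        using blocked[of q p d] T(1) ne by (auto simp: insert_commute)
      obtain rd od where d:
        "\<not> traceable x c p q \<or> adj rd d \<and> \<not> adj rd p \<and> \<not> adj rd q \<and> \<not> adj rd x \<and> \<not> adj rd c"
        "adj x d \<Longrightarrow> adj rd d \<Longrightarrow> \<not> adj rd x \<Longrightarrow> \<not> adj rd c \<Longrightarrow>
          adj od c \<and> \<not> adj od x \<and> \<not> adj od d \<and> (adj od p \<or> adj od q)"
        using blocked[of d p q] T(1) ne by (auto simp: insert_commute)
      show False
        by (rule local_shed_link[OF T(6) cY(2) p(1) q(1) d(1) p(2) q(2) d(2)])
    qed
    have "linear_quotients (insert c ` paths (insert c {x}) (Y - {c}) R \<union> paths {x} (Y - {c}) R)"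
    proof (rule linear_quotients_shed)
      show "linear_quotients (paths (insert c {x}) (Y - {c}) R)"
        using linear_quotients_pairs[of "Y - {c}" R x c] less.prems cY by (simp add: insert_commute)
      show "linear_quotients (paths {x} (Y - {c}) R)"
        using less.hyps[OF card_Diff1_less[OF less.prems(1) cY(1)]] less.prems by simp
    qed (use shed in \<open>auto simp: paths_def\<close>)
    then show ?thesis using paths_split[OF cY(1)] by simp
  qed
qed

text \<open>Pigeonhole: none of the four private neighbours sees \<open>x\<close>, so the three
  vertices of \<open>T\<close> must cover them, but each vertex covers at most one.\<close>

lemma rigid_path:
  assumes path: "adj a b" "adj b c" "adj c d"
    and priv: "(adj ra a \<and> \<not> adj ra b \<and> \<not> adj ra c \<and> \<not> adj ra d \<and> \<not> adj ra x) \<and>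
      (adj rb b \<and> \<not> adj rb a \<and> \<not> adj rb c \<and> \<not> adj rb d \<and> \<not> adj rb x) \<and>
      (adj rc c \<and> \<not> adj rc a \<and> \<not> adj rc b \<and> \<not> adj rc d \<and> \<not> adj rc x) \<and>
      (adj rd d \<and> \<not> adj rd a \<and> \<not> adj rd b \<and> \<not> adj rd c \<and> \<not> adj rd x)"
    and T: "card T = 3" "covers (insert x T) {ra, rb, rc, rd}"
  shows False
proof -
  obtain p q e where "T = {p, q, e}" using T(1) by (metis card_3_iff)
  then have "adj r p \<or> adj r q \<or> adj r e" if "r \<in> {ra, rb, rc, rd}" for r
    using that T(2) priv unfolding covers_def by auto
  then have "adj ra p \<or> adj ra q \<or> adj ra e" "adj rb p \<or> adj rb q \<or> adj rb e"
      "adj rc p \<or> adj rc q \<or> adj rc e" "adj rd p \<or> adj rd q \<or> adj rd e"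
    by simp_all
  moreover have "\<not> (adj ra e \<and> adj rb e)" "\<not> (adj ra e \<and> adj rc e)" "\<not> (adj ra e \<and> adj rd e)"
    "\<not> (adj rb e \<and> adj rc e)" "\<not> (adj rb e \<and> adj rd e)" "\<not> (adj rc e \<and> adj rd e)" for e
    using rigid_path_aux[OF path, of ra rb rc rd e] priv by simp_all
  ultimately show False by (smt (verit))
qed

text \<open>If the exchange fails because no path results, \<open>u\<close> itself is the
  placeholder for \<open>r\<close>. It can never be a private neighbour of \<open>u\<close>, so a
  later proof that \<open>r\<close> is one puts \<open>r\<close> back into \<open>R\<close>.\<close>

lemma blocked_vertex:
  assumes no: "\<not> (\<exists>y\<in>W. path4 (insert x (W - {y})) \<and> covers (insert x (W - {y})) R)"
    and W: "covers W R" "x \<notin> W" "W = {u, u1, u2, u3}" "distinct [u, u1, u2, u3]"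
  shows "\<exists>r. (r \<in> R \<or> r = u) \<and> (\<not> traceable x u1 u2 u3 \<or>
    adj r u \<and> \<not> adj r u1 \<and> \<not> adj r u2 \<and> \<not> adj r u3 \<and> \<not> adj r x)"
proof (cases "traceable x u1 u2 u3")
  case True
  have "distinct [x, u1, u2, u3]" using W by auto
  then have "path4 {x, u1, u2, u3}" using path4_iff True by blast
  moreover have "W - {u} = {u1, u2, u3}" using W by auto
  ultimately have "\<not> covers {x, u1, u2, u3} R" using no W(3) by auto
  then show ?thesis using W(1,3) unfolding covers_def by blast
qed auto

lemma path4_neighbour:
  assumes "path4 T" "x \<in> T"
  shows "\<exists>n\<in>T. adj x n"
  using assms by (elim path4E) (auto simp: adj_commute)

lemma linear_quotients_paths:
  assumes "finite Y" "finite R"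
  shows "linear_quotients (paths {} Y R)"
  using assms
proof (induction "card Y" arbitrary: Y R rule: less_induct)
  case less
  show ?case
  proof (cases "Y = {}")
    case True
    then have "paths {} Y R = {}" unfolding paths_def path4_def by auto
    then show ?thesis by (simp add: linear_quotients.empty)
  next
    case False
    from finite_has_max[OF less.prems(1) this, of "\<lambda>v. card (Collect (adj v) \<inter> R)"]
    obtain x where x: "x \<in> Y"
      and xR: "\<And>q. q \<in> Y \<Longrightarrow> card (Collect (adj q) \<inter> R) \<le> card (Collect (adj x) \<inter> R)" by blast
    \<comment> \<open>Meeting the neighbourhood of \<open>x\<close> becomes one more covering
      condition, so this family has the same shape with a smaller \<open>Y\<close>; this is why the
      induction leaves \<open>R\<close> arbitrary.\<close>
    define near where "near = paths {} (Y - {x}) (insert x R)"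
    define far where "far = paths {} (Y - {x} - Collect (adj x)) R"
    have split: "paths {} Y R = (insert x ` paths {x} (Y - {x}) R \<union> near) \<union> far"
    proof -
      have "paths {} (Y - {x}) R = near \<union> far"
        unfolding near_def far_def paths_def covers_def by auto
      then show ?thesis using paths_split[OF x, of "{}" R] by auto
    qed
    have smaller: "card (Y - {x}) < card Y" "card (Y - {x} - Collect (adj x)) < card Y"
      using x less.prems(1) by (metis card_Diff1_less)
        (use x less.prems(1) in \<open>auto intro!: psubset_card_mono\<close>)
    have card3: "card T = 3" if "T \<in> paths {x} (Y - {x}) R" for T
      using card_paths[OF _ _ that] by auto
    have shed: "\<exists>y\<in>W. W - {y} \<in> paths {x} (Y - {x}) R"
      if ne: "paths {x} (Y - {x}) R \<noteq> {}" and W: "W \<in> near" for W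
    proof (rule ccontr)
      assume no: "\<not> ?thesis"
      have W': "W \<subseteq> Y - {x}" "path4 W" "covers W R" "\<exists>w\<in>W. adj x w"
        using W unfolding near_def paths_def covers_def by auto
      from path4E[OF W'(2)] obtain a b c d where
        p: "distinct [a, b, c, d]" "W = {a, b, c, d}" "adj a b" "adj b c" "adj c d" by metis
      have no': "\<not> (\<exists>y\<in>W. path4 (insert x (W - {y})) \<and> covers (insert x (W - {y})) R)"
        using no W'(1) unfolding paths_def by auto
      have blocked: "\<exists>r e. (r \<in> R \<or> r = u) \<and> (\<not> traceable x u1 u2 u3 \<or>
            adj r u \<and> \<not> adj r u1 \<and> \<not> adj r u2 \<and> \<not> adj r u3 \<and> \<not> adj r x) \<and>
          (adj r u \<longrightarrow> \<not> adj r x \<longrightarrow> adj e x \<and> \<not> adj e u \<and> (adj e u1 \<or> adj e u2 \<or> adj e u3))"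
        if u: "W = {u, u1, u2, u3}" "distinct [u, u1, u2, u3]" for u u1 u2 u3
      proof (cases "traceable x u1 u2 u3")
        case True
        from blocked_vertex[OF no' W'(3) _ u] W'(1) True obtain r where
          r: "r \<in> R" "adj r u" "\<not> adj r u1" "\<not> adj r u2" "\<not> adj r u3" "\<not> adj r x"
          using irr by auto
        have "u \<in> Y" using W'(1) u by auto
        then obtain e where e: "adj x e" "e \<in> R" "\<not> adj u e"
          using card_Int_exchange[OF less.prems(2) xR, of u r] r sym by auto
        then have "adj e u1 \<or> adj e u2 \<or> adj e u3"
          using W'(3) u(1) sym unfolding covers_def by blast
        then show ?thesis using r e sym by blast
      next
        case False
        then show ?thesis using irr[of u] by blast
      qed
      obtain ra oa where a: "ra \<in> R \<or> ra = a"
        "\<not> traceable x b c d \<or> adj ra a \<and> \<not> adj ra b \<and> \<not> adj ra c \<and> \<not> adj ra d \<and> \<not> adj ra x"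
        "adj ra a \<Longrightarrow> \<not> adj ra x \<Longrightarrow> adj oa x \<and> \<not> adj oa a \<and> (adj oa b \<or> adj oa c \<or> adj oa d)"
        using blocked[of a b c d] p by auto
      obtain rb ob where b: "rb \<in> R \<or> rb = b"
        "\<not> traceable x a c d \<or> adj rb b \<and> \<not> adj rb a \<and> \<not> adj rb c \<and> \<not> adj rb d \<and> \<not> adj rb x"
        "adj rb b \<Longrightarrow> \<not> adj rb x \<Longrightarrow> adj ob x \<and> \<not> adj ob b \<and> (adj ob a \<or> adj ob c \<or> adj ob d)"
        using blocked[of b a c d] p by (auto simp: insert_commute)
      obtain rc oc where c: "rc \<in> R \<or> rc = c"
        "\<not> traceable x a b d \<or> adj rc c \<and> \<not> adj rc a \<and> \<not> adj rc b \<and> \<not> adj rc d \<and> \<not> adj rc x"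
        "adj rc c \<Longrightarrow> \<not> adj rc x \<Longrightarrow> adj oc x \<and> \<not> adj oc c \<and> (adj oc a \<or> adj oc b \<or> adj oc d)"
        using blocked[of c a b d] p by (auto simp: insert_commute)
      obtain rd od where d: "rd \<in> R \<or> rd = d"
        "\<not> traceable x a b c \<or> adj rd d \<and> \<not> adj rd a \<and> \<not> adj rd b \<and> \<not> adj rd c \<and> \<not> adj rd x"
        "adj rd d \<Longrightarrow> \<not> adj rd x \<Longrightarrow> adj od x \<and> \<not> adj od d \<and> (adj od a \<or> adj od b \<or> adj od c)"
        using blocked[of d a b c] p by (auto simp: insert_commute)
      have "adj x a \<or> adj x b \<or> adj x c \<or> adj x d" using W'(4) p(2) by auto
      note priv = local_shed[OF p(3-5) this a(2,3) b(2,3) c(2,3) d(2,3)]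
      \<comment> \<open>A placeholder would have to be adjacent to itself, so all four witnesses are
        in \<open>R\<close>. Any completion \<open>T\<close> of \<open>x\<close>, available because
        the link is non-empty, then covers them together with \<open>x\<close>, which is
        impossible.\<close>
      then have "{ra, rb, rc, rd} \<subseteq> R" using a(1) b(1) c(1) d(1) irr by auto
      moreover obtain T where "T \<in> paths {x} (Y - {x}) R" using ne by auto
      ultimately show False
        using rigid_path[OF p(3-5) priv, of T] card3[of T] unfolding paths_def covers_def by auto
    qed
    have swap: "\<exists>t\<in>T - W. \<exists>y\<in>W. insert t (W - {y}) \<in> insert x ` paths {x} (Y - {x}) R \<union> near"
      if W: "W \<in> far" and T: "T \<in> insert x ` paths {x} (Y - {x}) R \<union> near" for W T
    proof -
      have T': "T \<subseteq> Y" "path4 T" "covers T R"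
        using T x unfolding near_def paths_def covers_def by auto
      have "x \<in> T \<or> (\<exists>n\<in>T. adj x n)" using T unfolding near_def paths_def covers_def by auto
      \<comment> \<open>Since \<open>W\<close> sees nothing of \<open>x\<close>, the incoming vertex
        is a neighbour \<open>n\<close> of \<open>x\<close>. A path through \<open>x\<close>
        contains one too, and inserting it puts the new set into \<open>near\<close>.\<close>
      then obtain n where n: "n \<in> T" "adj x n" using path4_neighbour[OF T'(2)] by auto
      have W': "W \<subseteq> Y - {x}" "path4 W" "covers W R" "\<And>w. w \<in> W \<Longrightarrow> \<not> adj x w"
        using W unfolding far_def paths_def by auto
      have nW: "n \<notin> W" "n \<noteq> x" using n W'(4) irr by auto
      from path4E[OF W'(2)] obtain a b c d where
        p: "distinct [a, b, c, d]" "W = {a, b, c, d}" "adj a b" "adj b c" "adj c d" by metis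
      have "\<exists>y\<in>W. path4 (insert n (W - {y})) \<and> covers (insert n (W - {y})) R"
      proof (rule ccontr)
        assume no: "\<not> ?thesis"
        note blocked = blocked_vertex[OF no W'(3) nW(1)]
        obtain ra where a: "ra \<in> R \<or> ra = a"
          "\<not> traceable n b c d \<or> adj ra a \<and> \<not> adj ra b \<and> \<not> adj ra c \<and> \<not> adj ra d \<and> \<not> adj ra n"
          using blocked[of a b c d] p by auto
        obtain rb where b: "rb \<in> R \<or> rb = b"
          "\<not> traceable n a c d \<or> adj rb b \<and> \<not> adj rb a \<and> \<not> adj rb c \<and> \<not> adj rb d \<and> \<not> adj rb n"
          using blocked[of b a c d] p by (auto simp: insert_commute)
        obtain rc where c: "rc \<in> R \<or> rc = c"
          "\<not> traceable n a b d \<or> adj rc c \<and> \<not> adj rc a \<and> \<not> adj rc b \<and> \<not> adj rc d \<and> \<not> adj rc n"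
          using blocked[of c a b d] p by (auto simp: insert_commute)
        obtain rd where d: "rd \<in> R \<or> rd = d"
          "\<not> traceable n a b c \<or> adj rd d \<and> \<not> adj rd a \<and> \<not> adj rd b \<and> \<not> adj rd c \<and> \<not> adj rd n"
          using blocked[of d a b c] p by (auto simp: insert_commute)
        have "\<not> adj x a" "\<not> adj x b" "\<not> adj x c" "\<not> adj x d" using W'(4) p(2) by auto
        note priv = local_shed_remote[OF p(3-5) n(2) this a(2) b(2) c(2) d(2)]
        then have "{ra, rb, rc, rd} \<subseteq> R" using a(1) b(1) c(1) d(1) irr by auto
        moreover have "card (T - {n}) = 3" "insert n (T - {n}) = T"
          using n(1) card_path4[OF T'(2)] finite_path4[OF T'(2)] by auto
        ultimately show False
          using rigid_path[OF p(3-5) priv, of "T - {n}"] T'(3) unfolding covers_def by auto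
      qed
      then obtain y where y: "y \<in> W" "path4 (insert n (W - {y}))" "covers (insert n (W - {y})) R" by blast
      have "insert n (W - {y}) \<in> near"
        using y T'(1) n W'(1) nW unfolding near_def paths_def covers_def by auto
      then show ?thesis using y(1) n(1) nW(1) by blast
    qed
    show ?thesis
      unfolding split
    proof (rule linear_quotients_Un[OF _ linear_quotients_shed swap])
      show "linear_quotients far" "linear_quotients near"
        unfolding far_def near_def using less.hyps smaller less.prems by simp_all
      show "linear_quotients (paths {x} (Y - {x}) R)"
        by (rule linear_quotients_triples) (use less.prems in auto)
    qed (use shed in \<open>auto simp: paths_def near_def\<close>)
  qed
qed

end

section \<open>Homogeneous components\<close>

lemma zero_poly_ring [simp]: "0 \<in> poly_ring V"
  by (simp add: poly_ring_def)

lemma one_poly_ring [simp]: "1 \<in> poly_ring V"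
  by (simp add: poly_ring_def)

lemma add_poly_ring [simp]: "p \<in> poly_ring V \<Longrightarrow> q \<in> poly_ring V \<Longrightarrow> p + q \<in> poly_ring V"
  using Poly_Mapping.keys_add[of p q] unfolding poly_ring_def by blast

lemma uminus_poly_ring [simp]: "p \<in> poly_ring V \<Longrightarrow> - p \<in> poly_ring V"
  unfolding poly_ring_def by simp

lemma diff_poly_ring [simp]: "p \<in> poly_ring V \<Longrightarrow> q \<in> poly_ring V \<Longrightarrow> p - q \<in> poly_ring V"
  using Poly_Mapping.keys_diff[of p q] unfolding poly_ring_def by blast

lemma mult_poly_ring [simp]:
  assumes "p \<in> poly_ring V" "q \<in> poly_ring V"
  shows "p * q \<in> poly_ring V"
proof -
  have "Poly_Mapping.keys m \<subseteq> V" if "m \<in> Poly_Mapping.keys (p * q)" for m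
  proof -
    from that obtain a b where "m = a + b" "a \<in> Poly_Mapping.keys p" "b \<in> Poly_Mapping.keys q"
      using Poly_Mapping.keys_mult[of p q] by blast
    then show ?thesis
      using assms Poly_Mapping.keys_add[of a b] unfolding poly_ring_def by blast
  qed
  then show ?thesis by (simp add: poly_ring_def)
qed

lemma sum_poly_ring [simp]: "(\<And>i. i \<in> I \<Longrightarrow> f i \<in> poly_ring V) \<Longrightarrow> (\<Sum>i\<in>I. f i) \<in> poly_ring V"
  by (induction I rule: infinite_finite_induct) auto

lemma single_poly_ring [simp]: "Poly_Mapping.keys m \<subseteq> V \<Longrightarrow> Poly_Mapping.single m c \<in> poly_ring V"
  by (simp add: poly_ring_def)

lemma mdeg_superset:
  assumes "finite A" "Poly_Mapping.keys m \<subseteq> A"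
  shows "mdeg m = (\<Sum>v\<in>A. Poly_Mapping.lookup m v)"
  unfolding mdeg_def by (rule sum.mono_neutral_left) (use assms in \<open>auto simp: in_keys_iff\<close>)

lemma mdeg_add: "mdeg (m + n) = mdeg m + mdeg n"
proof -
  let ?A = "Poly_Mapping.keys m \<union> Poly_Mapping.keys n"
  have "mdeg (m + n) = (\<Sum>v\<in>?A. Poly_Mapping.lookup (m + n) v)"
    by (rule mdeg_superset) (use Poly_Mapping.keys_add[of m n] in auto)
  then show ?thesis
    by (simp add: lookup_add sum.distrib mdeg_superset[of ?A])
qed

lemma mdeg_zero [simp]: "mdeg 0 = 0"
  by (simp add: mdeg_def)

lemma mdeg_single [simp]: "mdeg (Poly_Mapping.single v n) = n"
  by (simp add: mdeg_def)

text \<open>The degree is an integer because components are taken at differences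
  \<open>j - A ! k\<close>, which may be negative and then give 0.\<close>

definition hcomp :: "int \<Rightarrow> ('v, 'k::field) mpoly \<Rightarrow> ('v, 'k) mpoly" where
  "hcomp d p = Abs_poly_mapping (\<lambda>m. Poly_Mapping.lookup p m when int (mdeg m) = d)"

lemma lookup_hcomp:
  "Poly_Mapping.lookup (hcomp d p) m = (Poly_Mapping.lookup p m when int (mdeg m) = d)"
proof -
  have "finite {m. (Poly_Mapping.lookup p m when int (mdeg m) = d) \<noteq> 0}"
    by (rule finite_subset[of _ "Poly_Mapping.keys p"]) (auto simp: in_keys_iff when_def split: if_splits)
  then show ?thesis by (simp add: hcomp_def)
qed

lemma keys_hcomp: "Poly_Mapping.keys (hcomp d p) = {m \<in> Poly_Mapping.keys p. int (mdeg m) = d}"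
  by (auto simp: in_keys_iff lookup_hcomp when_def split: if_splits)

lemma hcomp_add: "hcomp d (p + q) = hcomp d p + hcomp d q"
  by (rule poly_mapping_eqI) (simp add: lookup_hcomp lookup_add when_def)

lemma hcomp_zero [simp]: "hcomp d 0 = 0"
  by (rule poly_mapping_eqI) (simp add: lookup_hcomp)

lemma hcomp_sum: "hcomp d (\<Sum>i\<in>I. f i) = (\<Sum>i\<in>I. hcomp d (f i))"
  by (induction I rule: infinite_finite_induct) (auto simp: hcomp_add)

lemma hcomp_poly_ring [simp]: "p \<in> poly_ring V \<Longrightarrow> hcomp d p \<in> poly_ring V"
  by (auto simp: poly_ring_def keys_hcomp)

lemma homogeneous_hcomp [simp]: "homogeneous d (hcomp d p)"
  by (simp add: homogeneous_def keys_hcomp)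

lemma hcomp_homogeneous: "homogeneous d p \<Longrightarrow> hcomp e p = (if e = d then p else 0)"
  by (rule poly_mapping_eqI) (auto simp: homogeneous_def lookup_hcomp when_def in_keys_iff)

lemma homogeneous_zero [simp]: "homogeneous d 0"
  by (simp add: homogeneous_def)

lemma homogeneous_single: "homogeneous d (Poly_Mapping.single m c) \<longleftrightarrow> c = 0 \<or> int (mdeg m) = d"
  by (simp add: homogeneous_def)

lemma homogeneous_one [simp]: "homogeneous 0 1"
  by (simp add: homogeneous_def)

lemma mdeg_keys_mult:
  assumes "m \<in> Poly_Mapping.keys (p * q)" "homogeneous d q"
  shows "\<exists>a\<in>Poly_Mapping.keys p. int (mdeg m) = int (mdeg a) + d"
proof -
  from assms(1) obtain a b where "m = a + b" "a \<in> Poly_Mapping.keys p" "b \<in> Poly_Mapping.keys q"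
    using Poly_Mapping.keys_mult[of p q] by blast
  then show ?thesis using assms(2) by (auto simp: mdeg_add homogeneous_def)
qed

text \<open>Split off the component of \<open>p\<close> in degree \<open>e - d\<close>; the rest
  multiplied by \<open>q\<close> has no term of degree \<open>e\<close>.\<close>

lemma hcomp_mult:
  fixes p q :: "('v, 'k::field) mpoly"
  assumes "homogeneous d q"
  shows "hcomp e (p * q) = hcomp (e - d) p * q"
proof -
  define r where "r = p - hcomp (e - d) p"
  have r: "Poly_Mapping.keys r \<subseteq> {m. int (mdeg m) \<noteq> e - d}"
    by (auto simp: r_def in_keys_iff lookup_minus lookup_hcomp when_def)
  have "hcomp e (r * q) = 0"
  proof (rule poly_mapping_eqI)
    fix m
    have "m \<notin> Poly_Mapping.keys (r * q)" if "int (mdeg m) = e"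
      using mdeg_keys_mult[OF _ assms, of m r] r that by fastforce
    then show "Poly_Mapping.lookup (hcomp e (r * q)) m = Poly_Mapping.lookup 0 m"
      by (auto simp: lookup_hcomp when_def in_keys_iff)
  qed
  moreover have "homogeneous e (hcomp (e - d) p * q)"
    unfolding homogeneous_def
  proof
    fix m assume "m \<in> Poly_Mapping.keys (hcomp (e - d) p * q)"
    from mdeg_keys_mult[OF this assms] show "int (mdeg m) = e"
      by (auto simp: keys_hcomp)
  qed
  moreover have "p * q = r * q + hcomp (e - d) p * q"
    by (simp add: r_def algebra_simps)
  ultimately show ?thesis by (metis hcomp_add hcomp_homogeneous add_0)
qed

lemma hcomp_mult': "homogeneous d p \<Longrightarrow> hcomp e (p * q) = p * hcomp (e - d) q"
  using hcomp_mult[of d p e q] by (simp add: mult.commute)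

definition const_term :: "('v, 'k::field) mpoly \<Rightarrow> 'k" where
  "const_term p = Poly_Mapping.lookup p 0"

lemma mdeg_eq_0_iff: "mdeg m = 0 \<longleftrightarrow> m = 0"
  by (auto simp: mdeg_def in_keys_iff intro!: poly_mapping_eqI)

lemma const_term_add: "const_term (p + q) = const_term p + const_term q"
  by (simp add: const_term_def lookup_add)

lemma const_term_zero [simp]: "const_term 0 = 0"
  by (simp add: const_term_def)

lemma const_term_sum: "const_term (\<Sum>i\<in>I. f i) = (\<Sum>i\<in>I. const_term (f i))"
  by (induction I rule: infinite_finite_induct) (auto simp: const_term_add)

lemma const_term_hcomp: "const_term (hcomp d p) = (if d = 0 then const_term p else 0)"
  by (auto simp: const_term_def lookup_hcomp when_def)

lemma hcomp_0: "hcomp 0 p = Poly_Mapping.single 0 (const_term p)"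
  by (rule poly_mapping_eqI)
    (auto simp: const_term_def lookup_hcomp lookup_single mdeg_eq_0_iff when_def)

text \<open>This is the residue map modulo the variables. Terms of positive degree in
  \<open>p\<close> contribute nothing in degree 0, which reduces the claim to constants.\<close>

lemma const_term_mult:
  fixes p q :: "('v, 'k::field) mpoly"
  shows "const_term (p * q) = const_term p * const_term q"
proof -
  have "p * q = hcomp 0 p * q + (p - hcomp 0 p) * q" by (simp add: algebra_simps)
  moreover have "0 \<notin> Poly_Mapping.keys ((p - hcomp 0 p) * q)"
  proof
    assume "0 \<in> Poly_Mapping.keys ((p - hcomp 0 p) * q)"
    then obtain a b where ab: "0 = a + b" "a \<in> Poly_Mapping.keys (p - hcomp 0 p)"
      using Poly_Mapping.keys_mult[of "p - hcomp 0 p" q] by blast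
    have "mdeg (0 :: 'v \<Rightarrow>\<^sub>0 nat) = mdeg a + mdeg b" using ab(1) mdeg_add by metis
    then have "a = 0" by (simp add: mdeg_eq_0_iff)
    then show False using ab(2) by (simp add: in_keys_iff lookup_minus lookup_hcomp)
  qed
  ultimately have "const_term (p * q) = const_term (hcomp 0 p * q)"
    by (simp add: const_term_add) (simp add: const_term_def in_keys_iff)
  also have "\<dots> = const_term (hcomp 0 (hcomp 0 p * q))"
    by (simp add: const_term_hcomp)
  also have "hcomp 0 (hcomp 0 p * q) = hcomp 0 p * hcomp 0 q"
    using hcomp_mult'[OF homogeneous_hcomp, of 0 0 p q] by simp
  also have "\<dots> = Poly_Mapping.single 0 (const_term p * const_term q)"
    by (simp add: hcomp_0 mult_single)
  finally show ?thesis by (simp add: const_term_def)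
qed

section \<open>Comparison of graded free resolutions\<close>

text \<open>Same as \<open>free_module\<close>, but dependent only on the list of degrees, so that
  maps between terms of different complexes can be described.\<close>

definition graded_free :: "'v set \<Rightarrow> int list \<Rightarrow> (nat \<Rightarrow> ('v, 'k::field) mpoly) set" where
  "graded_free V A = {x. (\<forall>k<length A. x k \<in> poly_ring V) \<and> (\<forall>k\<ge>length A. x k = 0)}"

definition vcomp :: "int list \<Rightarrow> int \<Rightarrow> (nat \<Rightarrow> ('v, 'k::field) mpoly) \<Rightarrow> (nat \<Rightarrow> ('v, 'k) mpoly)" where
  "vcomp A j x = (\<lambda>k. if k < length A then hcomp (j - A ! k) (x k) else 0)"

text \<open>Degree-preserving linear maps as functions instead of matrices, which keeps composites
  and homotopies simple; nothing is required outside the carrier.\<close>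

definition graded_map ::
    "'v set \<Rightarrow> int list \<Rightarrow> int list \<Rightarrow> ((nat \<Rightarrow> ('v, 'k::field) mpoly) \<Rightarrow> (nat \<Rightarrow> ('v, 'k) mpoly)) \<Rightarrow> bool" where
  "graded_map V A B f \<longleftrightarrow>
     (\<forall>x\<in>graded_free V A. f x \<in> graded_free V B) \<and>
     (\<forall>x\<in>graded_free V A. \<forall>y\<in>graded_free V A. f (\<lambda>k. x k + y k) = (\<lambda>k. f x k + f y k)) \<and>
     (\<forall>a\<in>poly_ring V. \<forall>x\<in>graded_free V A. f (\<lambda>k. a * x k) = (\<lambda>k. a * f x k)) \<and>
     (\<forall>x\<in>graded_free V A. \<forall>j. f (vcomp A j x) = vcomp B j (f x))"

lemma graded_free_diff: "x \<in> graded_free V A \<Longrightarrow> y \<in> graded_free V A \<Longrightarrow> (\<lambda>k. x k - y k) \<in> graded_free V A"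
  by (simp add: graded_free_def)

lemma graded_free_mult: "a \<in> poly_ring V \<Longrightarrow> x \<in> graded_free V A \<Longrightarrow> (\<lambda>k. a * x k) \<in> graded_free V A"
  by (simp add: graded_free_def)

lemma graded_free_zero: "(\<lambda>k. 0) \<in> graded_free V A"
  by (simp add: graded_free_def)

lemma graded_free_coeff: "x \<in> graded_free V A \<Longrightarrow> x k \<in> poly_ring V"
  unfolding graded_free_def by (cases "k < length A") auto

lemma graded_free_sum:
  "(\<And>i. i \<in> I \<Longrightarrow> z i \<in> graded_free V A) \<Longrightarrow> (\<lambda>k. \<Sum>i\<in>I. z i k) \<in> graded_free V A"
  by (auto simp: graded_free_def)

lemma vcomp_free: "x \<in> graded_free V A \<Longrightarrow> vcomp A j x \<in> graded_free V A"
  by (simp add: graded_free_def vcomp_def)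

lemma graded_mapD:
  assumes "graded_map V A B f" "x \<in> graded_free V A"
  shows "f x \<in> graded_free V B" "y \<in> graded_free V A \<Longrightarrow> f (\<lambda>k. x k + y k) = (\<lambda>k. f x k + f y k)"
    "a \<in> poly_ring V \<Longrightarrow> f (\<lambda>k. a * x k) = (\<lambda>k. a * f x k)"
    "f (vcomp A j x) = vcomp B j (f x)"
  using assms unfolding graded_map_def by auto

lemma graded_map_zero: "graded_map V A B f \<Longrightarrow> f (\<lambda>k. 0) = (\<lambda>k. 0)"
  using graded_mapD(3)[OF _ graded_free_zero, of V A B f 0] by simp

lemma graded_map_diff:
  assumes f: "graded_map V A B f" and x: "x \<in> graded_free V A" and y: "y \<in> graded_free V A"
  shows "f (\<lambda>k. x k - y k) = (\<lambda>k. f x k - f y k)"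
proof -
  have m: "(-1) \<in> poly_ring V" by simp
  have "f (\<lambda>k. x k + (-1) * y k) = (\<lambda>k. f x k + f (\<lambda>k. (-1) * y k) k)"
    by (rule graded_mapD(2)[OF f x graded_free_mult[OF m y]])
  then show ?thesis using graded_mapD(3)[OF f y m] by simp
qed

lemma graded_map_sum:
  assumes f: "graded_map V A B f" and "finite I"
    and "\<And>i. i \<in> I \<Longrightarrow> a i \<in> poly_ring V" "\<And>i. i \<in> I \<Longrightarrow> z i \<in> graded_free V A"
  shows "f (\<lambda>k. \<Sum>i\<in>I. a i * z i k) = (\<lambda>k. \<Sum>i\<in>I. a i * f (z i) k)"
  using assms(2-4)
proof (induction I)
  case empty
  then show ?case using graded_map_zero[OF f] by simp
next
  case (insert i I)
  have "f (\<lambda>k. a i * z i k + (\<Sum>i\<in>I. a i * z i k)) = (\<lambda>k. f (\<lambda>k. a i * z i k) k + f (\<lambda>k. \<Sum>i\<in>I. a i * z i k) k)"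
    by (rule graded_mapD(2)[OF f]) (use insert.prems in \<open>auto intro!: graded_free_mult graded_free_sum\<close>)
  then show ?case
    using insert graded_mapD(3)[OF f, of "z i" "a i"] by simp
qed

definition unit_vec :: "nat \<Rightarrow> nat \<Rightarrow> ('v, 'k::field) mpoly" where
  "unit_vec l = (\<lambda>k. if k = l then 1 else 0)"

lemma unit_vec_free: "l < length A \<Longrightarrow> unit_vec l \<in> graded_free V A"
  by (simp add: unit_vec_def graded_free_def)

lemma vcomp_unit_vec: "l < length A \<Longrightarrow> vcomp A (A ! l) (unit_vec l) = unit_vec l"
  by (rule ext) (simp add: vcomp_def unit_vec_def hcomp_homogeneous[of 0])

lemma graded_free_expand:
  assumes "x \<in> graded_free V A"
  shows "x = (\<lambda>k. \<Sum>l<length A. x l * unit_vec l k)"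
proof
  fix k
  have "(\<Sum>l<length A. x l * unit_vec l k) = (\<Sum>l<length A. if k = l then x l else 0)"
    by (rule sum.cong) (auto simp: unit_vec_def)
  then show "x k = (\<Sum>l<length A. x l * unit_vec l k)"
    using assms by (auto simp: graded_free_def)
qed

lemma graded_map_expand:
  assumes "graded_map V A B f" "x \<in> graded_free V A"
  shows "f x = (\<lambda>k. \<Sum>l<length A. x l * f (unit_vec l) k)"
proof -
  have "f (\<lambda>k. \<Sum>l<length A. x l * unit_vec l k) = (\<lambda>k. \<Sum>l<length A. x l * f (unit_vec l) k)"
    by (rule graded_map_sum[OF assms(1)]) (use assms(2) in \<open>auto simp: unit_vec_free graded_free_coeff\<close>)
  then show ?thesis using graded_free_expand[OF assms(2)] by simp
qed

lemma graded_map_const_term: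
  assumes "graded_map V A B f" "x \<in> graded_free V A" "\<And>k. const_term (x k) = 0"
  shows "const_term (f x k) = 0"
  by (simp add: graded_map_expand[OF assms(1,2)] const_term_sum const_term_mult assms(3))

lemma graded_map_of_columns:
  assumes "\<And>l. l < length A \<Longrightarrow> z l \<in> graded_free V B"
    and "\<And>l k. l < length A \<Longrightarrow> k < length B \<Longrightarrow> homogeneous (A ! l - B ! k) (z l k)"
  shows "graded_map V A B (\<lambda>x k. if k < length B then \<Sum>l<length A. z l k * x l else 0)"
  unfolding graded_map_def
proof (intro conjI ballI allI)
  fix x :: "nat \<Rightarrow> ('a, 'b) mpoly" and j
  assume x: "x \<in> graded_free V A"
  show "(\<lambda>k. if k < length B then \<Sum>l<length A. z l k * x l else 0) \<in> graded_free V B"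
    using assms(1) x by (auto simp: graded_free_def intro!: sum_poly_ring mult_poly_ring)
  have "hcomp (j - B ! k) (z l k * x l) = z l k * hcomp (j - A ! l) (x l)"
    if "k < length B" "l < length A" for k l
    using hcomp_mult'[OF assms(2)[OF that(2,1)], of "j - B ! k" "x l"] by (simp add: algebra_simps)
  then show "(\<lambda>k. if k < length B then \<Sum>l<length A. z l k * vcomp A j x l else 0) =
      vcomp B j (\<lambda>k. if k < length B then \<Sum>l<length A. z l k * x l else 0)"
    by (auto simp: vcomp_def hcomp_sum fun_eq_iff)
qed (auto simp: fun_eq_iff sum.distrib sum_distrib_left algebra_simps)

text \<open>Projectivity of graded free modules: a preimage is chosen for each basis element and cut
  down to its component in the degree of that element, which makes the lift graded.\<close>

lemma graded_map_lift:
  assumes d: "graded_map V Y' Y d" and \<phi>: "graded_map V P Y \<phi>"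
    and im: "\<And>x. x \<in> graded_free V P \<Longrightarrow> \<phi> x \<in> d ` graded_free V Y'"
  obtains \<psi> where "graded_map V P Y' \<psi>" "\<And>x. x \<in> graded_free V P \<Longrightarrow> d (\<psi> x) = \<phi> x"
proof -
  have "\<exists>z. z \<in> graded_free V Y' \<and> vcomp Y' (P ! l) z = z \<and> d z = \<phi> (unit_vec l)" if l: "l < length P" for l
  proof -
    obtain y where y: "y \<in> graded_free V Y'" "d y = \<phi> (unit_vec l)"
      using im[OF unit_vec_free[OF l]] by auto
    have "d (vcomp Y' (P ! l) y) = vcomp Y (P ! l) (\<phi> (unit_vec l))"
      using graded_mapD(4)[OF d y(1)] y(2) by simp
    also have "\<dots> = \<phi> (unit_vec l)"
      using graded_mapD(4)[OF \<phi> unit_vec_free[OF l]] vcomp_unit_vec[OF l] by metis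
    finally show ?thesis
      using vcomp_free[OF y(1)]
      by (intro exI[of _ "vcomp Y' (P ! l) y"]) (auto simp: vcomp_def fun_eq_iff hcomp_homogeneous[OF homogeneous_hcomp])
  qed
  then obtain z where z: "\<And>l. l < length P \<Longrightarrow> z l \<in> graded_free V Y'"
      "\<And>l. l < length P \<Longrightarrow> vcomp Y' (P ! l) (z l) = z l"
      "\<And>l. l < length P \<Longrightarrow> d (z l) = \<phi> (unit_vec l)"
    by metis
  define \<psi> where "\<psi> = (\<lambda>(x :: nat \<Rightarrow> ('a, 'b) mpoly) k. if k < length Y' then \<Sum>l<length P. z l k * x l else 0)"
  have "graded_map V P Y' \<psi>"
    unfolding \<psi>_def
  proof (rule graded_map_of_columns[OF z(1)])
    fix l k assume "l < length P" "k < length Y'"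
    then show "homogeneous (P ! l - Y' ! k) (z l k)"
      using fun_cong[OF z(2), of l k] homogeneous_hcomp by (metis (no_types, lifting) vcomp_def)
  qed
  moreover have "d (\<psi> x) = \<phi> x" if x: "x \<in> graded_free V P" for x
  proof -
    have "\<psi> x = (\<lambda>k. \<Sum>l<length P. x l * z l k)"
      using z(1) by (auto simp: \<psi>_def fun_eq_iff graded_free_def mult.commute)
    then have "d (\<psi> x) = (\<lambda>k. \<Sum>l<length P. x l * d (z l) k)"
      using graded_map_sum[OF d, of "{..<length P}" x z] z(1) graded_free_coeff[OF x] by simp
    then show ?thesis
      using graded_map_expand[OF \<phi> x] z(3) by simp
  qed
  ultimately show thesis using that by blast
qed

lemma graded_map_comp:
  assumes "graded_map V A B f" "graded_map V B C g"
  shows "graded_map V A C (\<lambda>x. g (f x))"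
  using assms unfolding graded_map_def by simp

lemma graded_map_id: "graded_map V A A (\<lambda>x. x)"
  unfolding graded_map_def by simp

lemma graded_map_minus:
  assumes "graded_map V A B f" "graded_map V A B g"
  shows "graded_map V A B (\<lambda>x k. f x k - g x k)"
proof -
  have "hcomp j (p - q) = hcomp j p - hcomp j q" for j and p q :: "('a, 'b) mpoly"
    by (rule poly_mapping_eqI) (simp add: lookup_hcomp lookup_minus when_def)
  then show ?thesis
    using assms unfolding graded_map_def
    by (auto simp: fun_eq_iff algebra_simps vcomp_def intro: graded_free_diff)
qed

lemma graded_map_const_zero: "graded_map V A B (\<lambda>x k. 0)"
  unfolding graded_map_def by (auto simp: graded_free_zero vcomp_def)

text \<open>Index 0 is the common target of the two augmentations, where the map is the identity.
  The third clause of the invariant \<open>?P\<close> says exactly that the next lift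
  exists.\<close>

lemma comparison_map:
  assumes N: "\<And>i. graded_map V (D (Suc i)) (D i) (N i)"
    and N': "\<And>i. graded_map V (D' (Suc i)) (D' i) (N' i)"
    and complex: "\<And>i x. x \<in> graded_free V (D (Suc (Suc i))) \<Longrightarrow> N i (N (Suc i) x) = (\<lambda>k. 0)"
    and exact': "\<And>i. {x \<in> graded_free V (D' (Suc i)). N' i x = (\<lambda>k. 0)} = N' (Suc i) ` graded_free V (D' (Suc (Suc i)))"
    and D0: "D' 0 = D 0"
    and im: "N 0 ` graded_free V (D 1) \<subseteq> N' 0 ` graded_free V (D' 1)"
  obtains f where "f 0 = (\<lambda>x. x)" "\<And>i. graded_map V (D i) (D' i) (f i)"
    "\<And>i x. x \<in> graded_free V (D (Suc i)) \<Longrightarrow> N' i (f (Suc i) x) = f i (N i x)"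
proof -
  let ?P = "\<lambda>i f. graded_map V (D i) (D' i) f \<and> (i = 0 \<longrightarrow> f = (\<lambda>x. x)) \<and>
      (\<forall>x\<in>graded_free V (D (Suc i)). f (N i x) \<in> N' i ` graded_free V (D' (Suc i)))"
  have "\<exists>f. \<forall>i. ?P i (f i) \<and> (\<forall>x\<in>graded_free V (D (Suc i)). N' i (f (Suc i) x) = f i (N i x))"
  proof (rule dependent_nat_choice)
    show "\<exists>f. ?P 0 f"
      using im D0 graded_map_id by (intro exI[of _ "\<lambda>x. x"]) auto
  next
    fix f i assume f: "?P i f"
    then have "graded_map V (D i) (D' i) f" by blast
    note fN = graded_map_comp[OF N[of i] this]
    obtain g where g: "graded_map V (D (Suc i)) (D' (Suc i)) g"
        "\<And>x. x \<in> graded_free V (D (Suc i)) \<Longrightarrow> N' i (g x) = f (N i x)"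
      by (rule graded_map_lift[OF N'[of i] fN]) (use f in auto)
    have "g (N (Suc i) x) \<in> N' (Suc i) ` graded_free V (D' (Suc (Suc i)))"
      if x: "x \<in> graded_free V (D (Suc (Suc i)))" for x
    proof -
      have Nx: "N (Suc i) x \<in> graded_free V (D (Suc i))" using graded_mapD(1)[OF N x] .
      have "N' i (g (N (Suc i) x)) = f (N i (N (Suc i) x))" using g(2)[OF Nx] .
      also have "\<dots> = (\<lambda>k. 0)" using complex[OF x] f graded_map_zero by metis
      finally show ?thesis using exact'[of i] graded_mapD(1)[OF g(1) Nx] by blast
    qed
    then show "\<exists>g. ?P (Suc i) g \<and> (\<forall>x\<in>graded_free V (D (Suc i)). N' i (g x) = f (N i x))"
      using g by blast
  qed
  then obtain f where f: "\<And>i. ?P i (f i)" "\<And>i x. x \<in> graded_free V (D (Suc i)) \<Longrightarrow> N' i (f (Suc i) x) = f i (N i x)"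
    by blast
  then show thesis using that[of f] by blast
qed

text \<open>An endomorphism \<open>e\<close> that is the identity at index 0 is homotopic to the
  identity, with \<open>h 0 = 0\<close>. The invariant \<open>?P\<close> makes
  \<open>x - e x - h (N x)\<close> a cycle, hence liftable.\<close>

lemma contracting_homotopy:
  assumes N: "\<And>i. graded_map V (D (Suc i)) (D i) (N i)"
    and exact: "\<And>i. {x \<in> graded_free V (D (Suc i)). N i x = (\<lambda>k. 0)} = N (Suc i) ` graded_free V (D (Suc (Suc i)))"
    and e0: "e 0 = (\<lambda>x. x)" and e: "\<And>i. graded_map V (D i) (D i) (e i)"
    and eN: "\<And>i x. x \<in> graded_free V (D (Suc i)) \<Longrightarrow> N i (e (Suc i) x) = e i (N i x)"
  obtains h where "\<And>i. graded_map V (D i) (D (Suc i)) (h i)"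
    "\<And>i x. x \<in> graded_free V (D (Suc i)) \<Longrightarrow>
      x = (\<lambda>k. N (Suc i) (h (Suc i) x) k + h i (N i x) k + e (Suc i) x k)"
proof -
  let ?P = "\<lambda>i h. graded_map V (D i) (D (Suc i)) h \<and>
      (\<forall>x\<in>graded_free V (D (Suc i)). N i (h (N i x)) = (\<lambda>k. N i x k - e i (N i x) k))"
  have "\<exists>h. \<forall>i. ?P i (h i) \<and> (\<forall>x\<in>graded_free V (D (Suc i)).
      N (Suc i) (h (Suc i) x) = (\<lambda>k. (x k - e (Suc i) x k) - h i (N i x) k))"
  proof (rule dependent_nat_choice)
    show "\<exists>h. ?P 0 h"
      using e0 graded_map_const_zero graded_map_zero[OF N] by (intro exI[of _ "\<lambda>x k. 0"]) auto
  next
    fix h i assume h: "?P i h"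
    then have "graded_map V (D i) (D (Suc i)) h" by blast
    note hN = graded_map_comp[OF N[of i] this]
    note \<phi> = graded_map_minus[OF graded_map_minus[OF graded_map_id e[of "Suc i"]] hN]
    have im: "(\<lambda>k. (x k - e (Suc i) x k) - h (N i x) k) \<in> N (Suc i) ` graded_free V (D (Suc (Suc i)))"
      if x: "x \<in> graded_free V (D (Suc i))" for x
    proof -
      have ex: "e (Suc i) x \<in> graded_free V (D (Suc i))" using graded_mapD(1)[OF e x] .
      have "N i (\<lambda>k. (x k - e (Suc i) x k) - h (N i x) k) = (\<lambda>k. (N i x k - N i (e (Suc i) x) k) - N i (h (N i x)) k)"
        using graded_map_diff[OF N graded_free_diff[OF x ex] graded_mapD(1)[OF hN x]] graded_map_diff[OF N x ex]
        by simp
      also have "\<dots> = (\<lambda>k. 0)" using h x eN[OF x] by simp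
      finally show ?thesis using exact[of i] graded_mapD(1)[OF \<phi> x] by blast
    qed
    obtain g where g: "graded_map V (D (Suc i)) (D (Suc (Suc i))) g"
        "\<And>x. x \<in> graded_free V (D (Suc i)) \<Longrightarrow> N (Suc i) (g x) = (\<lambda>k. (x k - e (Suc i) x k) - h (N i x) k)"
      by (rule graded_map_lift[OF N[of "Suc i"] \<phi>]) (use im in auto)
    have "N (Suc i) (g (N (Suc i) x)) = (\<lambda>k. N (Suc i) x k - e (Suc i) (N (Suc i) x) k)"
      if x: "x \<in> graded_free V (D (Suc (Suc i)))" for x
    proof -
      have Nx: "N (Suc i) x \<in> graded_free V (D (Suc i))" using graded_mapD(1)[OF N x] .
      have "N i (N (Suc i) x) = (\<lambda>k. 0)" using exact[of i] x by blast
      then have "h (N i (N (Suc i) x)) = (\<lambda>k. 0)" using h graded_map_zero by metis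
      then show ?thesis using g(2)[OF Nx] by simp
    qed
    then show "\<exists>g. ?P (Suc i) g \<and> (\<forall>x\<in>graded_free V (D (Suc i)).
        N (Suc i) (g x) = (\<lambda>k. (x k - e (Suc i) x k) - h (N i x) k))"
      using g by blast
  qed
  then obtain h where h: "\<And>i. ?P i (h i)" "\<And>i x. x \<in> graded_free V (D (Suc i)) \<Longrightarrow>
      N (Suc i) (h (Suc i) x) = (\<lambda>k. (x k - e (Suc i) x k) - h i (N i x) k)"
    by blast
  show thesis
  proof (rule that[of h])
    show "graded_map V (D i) (D (Suc i)) (h i)" for i using h(1) by blast
    show "x = (\<lambda>k. N (Suc i) (h (Suc i) x) k + h i (N i x) k + e (Suc i) x k)"
      if "x \<in> graded_free V (D (Suc i))" for i x
      using h(2)[OF that] by simp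
  qed
qed


text \<open>The resolution is prolonged by the ring itself, generated in degree 0, so all indices
  move up by one and the term \<open>F i\<close> stands at index \<open>Suc i\<close>. All
  resolutions of \<open>J\<close> thereby share their term at index 0.\<close>

definition aug_degs :: "('v, 'k::field) free_complex \<Rightarrow> nat \<Rightarrow> int list" where
  "aug_degs F i = (case i of 0 \<Rightarrow> [0] | Suc j \<Rightarrow> gen_degs F j)"

definition aug_diff ::
    "('v, 'k::field) free_complex \<Rightarrow> nat \<Rightarrow> (nat \<Rightarrow> ('v, 'k) mpoly) \<Rightarrow> (nat \<Rightarrow> ('v, 'k) mpoly)" where
  "aug_diff F i = (case i of 0 \<Rightarrow> (\<lambda>x k. if k = 0 then aug_map F x else 0) | Suc j \<Rightarrow> diff_map F j)"

lemma aug_simps [simp]: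
  "aug_degs F 0 = [0]" "aug_degs F (Suc i) = gen_degs F i"
  "aug_diff F 0 = (\<lambda>x k. if k = 0 then aug_map F x else 0)" "aug_diff F (Suc i) = diff_map F i"
  by (simp_all add: aug_degs_def aug_diff_def)

lemma free_module_eq: "free_module V F i = graded_free V (gen_degs F i)"
  by (simp add: free_module_def graded_free_def free_rank_def)

lemma graded_map_aug_diff:
  assumes "graded_free_resolution V J F"
  shows "graded_map V (aug_degs F (Suc i)) (aug_degs F i) (aug_diff F i)"
proof (cases i)
  case 0
  have "graded_map V (gen_degs F 0) [0] (\<lambda>x k. if k < length [0 :: int] then
      \<Sum>l<length (gen_degs F 0). (\<lambda>k. if k = 0 then aug F l else 0) k * x l else 0)"
    by (rule graded_map_of_columns)
      (use assms in \<open>auto simp: graded_free_resolution_def graded_free_def free_rank_def\<close>)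
  moreover have "aug_diff F 0 = (\<lambda>x k. if k < length [0 :: int] then
      \<Sum>l<length (gen_degs F 0). (\<lambda>k. if k = 0 then aug F l else 0) k * x l else 0)"
    by (auto simp: aug_map_def free_rank_def fun_eq_iff)
  ultimately show ?thesis using 0 by simp
next
  case (Suc i')
  have "graded_map V (gen_degs F (Suc i')) (gen_degs F i') (\<lambda>x k. if k < length (gen_degs F i') then
      \<Sum>l<length (gen_degs F (Suc i')). (\<lambda>k. if k < length (gen_degs F i') then dmat F i' k l else 0) k * x l else 0)"
    by (rule graded_map_of_columns)
      (use assms in \<open>auto simp: graded_free_resolution_def graded_free_def free_rank_def\<close>)
  moreover have "diff_map F i' = (\<lambda>x k. if k < length (gen_degs F i') then
      \<Sum>l<length (gen_degs F (Suc i')). (\<lambda>k. if k < length (gen_degs F i') then dmat F i' k l else 0) k * x l else 0)"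
    by (auto simp: diff_map_def free_rank_def fun_eq_iff)
  ultimately show ?thesis using Suc by simp
qed

lemma aug_diff_exact:
  assumes "graded_free_resolution V J F"
  shows "{x \<in> graded_free V (aug_degs F (Suc i)). aug_diff F i x = (\<lambda>k. 0)} =
    aug_diff F (Suc i) ` graded_free V (aug_degs F (Suc (Suc i)))"
proof (cases i)
  case 0
  have "(\<lambda>k. if k = (0 :: nat) then p else 0) = (\<lambda>k. 0) \<longleftrightarrow> p = 0" for p :: "('a, 'b) mpoly"
    by (auto simp: fun_eq_iff)
  then show ?thesis using assms 0 by (simp add: graded_free_resolution_def free_module_eq)
next
  case (Suc i')
  then show ?thesis using assms by (simp add: graded_free_resolution_def free_module_eq)
qed

lemma aug_diff_image:
  assumes "graded_free_resolution V J F"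
  shows "aug_diff F 0 ` graded_free V (aug_degs F 1) = (\<lambda>p k. if k = 0 then p else 0) ` J"
proof -
  have "J = aug_map F ` graded_free V (gen_degs F 0)"
    using assms by (simp add: graded_free_resolution_def free_module_eq)
  then show ?thesis by (auto simp: image_image)
qed

lemma tensor_diff_const_term:
  "tensor_diff F i (\<lambda>k. const_term (x k)) = (\<lambda>k. const_term (diff_map F i x k))"
  by (auto simp: tensor_diff_def diff_map_def const_term_sum const_term_mult const_term_def[of "dmat F i _ _"])

lemma const_term_tensor_part:
  assumes "x \<in> free_module V F i" "vcomp (gen_degs F i) j x = x"
  shows "(\<lambda>k. const_term (x k)) \<in> tensor_part F i j"
  unfolding tensor_part_def
proof (intro CollectI allI impI)
  fix k assume nz: "const_term (x k) \<noteq> 0"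
  then have "k < free_rank F i"
    using assms(1) by (metis (mono_tags, lifting) const_term_zero free_module_def mem_Collect_eq not_le)
  moreover have "const_term (x k) = const_term (vcomp (gen_degs F i) j x k)" using assms(2) by simp
  ultimately show "k < free_rank F i \<and> gen_degs F i ! k = j"
    using nz by (auto simp: vcomp_def const_term_hcomp free_rank_def split: if_splits)
qed

text \<open>The identity of \<open>F\<close> factors up to homotopy through the linear resolution \<open>L\<close>, and over
  the residue field this factorisation vanishes outside the linear strand.\<close>

lemma tensor_cycle_is_boundary:
  assumes F: "graded_free_resolution V J F" and L: "graded_free_resolution V J L"
    and lin: "\<And>i k. k < free_rank L i \<Longrightarrow> gen_degs L i ! k = int (i + d)"
    and i: "i \<ge> 1" and j: "j \<noteq> int (i + d)" and c: "c \<in> tensor_cycles F i j"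
  shows "c \<in> tensor_boundaries F i j"
proof -
  let ?D = "aug_degs F" and ?N = "aug_diff F" and ?D' = "aug_degs L" and ?N' = "aug_diff L"
  have complex: "?N i (?N (Suc i) x) = (\<lambda>k. 0)" if "x \<in> graded_free V (?D (Suc (Suc i)))" for i x
    using aug_diff_exact[OF F, of i] that by blast
  have complex': "?N' i (?N' (Suc i) x) = (\<lambda>k. 0)" if "x \<in> graded_free V (?D' (Suc (Suc i)))" for i x
    using aug_diff_exact[OF L, of i] that by blast
  have im: "?N 0 ` graded_free V (?D 1) = ?N' 0 ` graded_free V (?D' 1)"
    using aug_diff_image[OF F] aug_diff_image[OF L] by simp
  obtain f where f: "f 0 = (\<lambda>x. x)" "\<And>i. graded_map V (?D i) (?D' i) (f i)"
      "\<And>i x. x \<in> graded_free V (?D (Suc i)) \<Longrightarrow> ?N' i (f (Suc i) x) = f i (?N i x)"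
    by (rule comparison_map[where D = ?D and D' = ?D' and N = ?N and N' = ?N',
        OF graded_map_aug_diff[OF F] graded_map_aug_diff[OF L] complex aug_diff_exact[OF L]])
      (use im in auto)
  obtain g where g: "g 0 = (\<lambda>x. x)" "\<And>i. graded_map V (?D' i) (?D i) (g i)"
      "\<And>i x. x \<in> graded_free V (?D' (Suc i)) \<Longrightarrow> ?N i (g (Suc i) x) = g i (?N' i x)"
    by (rule comparison_map[where D = ?D' and D' = ?D and N = ?N' and N' = ?N,
        OF graded_map_aug_diff[OF L] graded_map_aug_diff[OF F] complex' aug_diff_exact[OF F]])
      (use im in auto)
  have e0: "(\<lambda>x. g 0 (f 0 x)) = (\<lambda>x. x)" using f(1) g(1) by simp
  have e: "graded_map V (?D i) (?D i) (\<lambda>x. g i (f i x))" for i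
    by (rule graded_map_comp[OF f(2) g(2)])
  have eN: "?N i (g (Suc i) (f (Suc i) x)) = g i (f i (?N i x))" if "x \<in> graded_free V (?D (Suc i))" for i x
    using g(3)[OF graded_mapD(1)[OF f(2) that]] f(3)[OF that] by simp
  obtain h where h: "\<And>i. graded_map V (?D i) (?D (Suc i)) (h i)"
    "\<And>i x. x \<in> graded_free V (?D (Suc i)) \<Longrightarrow>
      x = (\<lambda>k. ?N (Suc i) (h (Suc i) x) k + h i (?N i x) k + g (Suc i) (f (Suc i) x) k)"
    by (rule contracting_homotopy[where D = ?D and N = ?N and e = "\<lambda>i x. g i (f i x)",
        OF graded_map_aug_diff[OF F] aug_diff_exact[OF F] e0 e eN]) auto
  obtain i' where i': "i = Suc i'" using i by (cases i) auto
  define X :: "nat \<Rightarrow> ('a, 'b) mpoly" where "X = (\<lambda>k. Poly_Mapping.single 0 (c k))"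
  have cX: "const_term (X k) = c k" for k by (simp add: X_def const_term_def)
  \<comment> \<open>The vector \<open>X\<close> lifts \<open>c\<close> to constants; as
    \<open>c\<close> is supported on generators of degree \<open>j\<close>, it is homogeneous of
    degree \<open>j\<close>.\<close>
  have cpart: "c \<in> tensor_part F i j" and cyc: "tensor_diff F i' c = (\<lambda>k. 0)"
    using c i' unfolding tensor_cycles_def by auto
  have "c k = 0" if "length (gen_degs F i) \<le> k" for k
    using cpart that unfolding tensor_part_def free_rank_def by force
  then have X: "X \<in> graded_free V (?D (Suc i))"
    unfolding X_def graded_free_def by simp
  have "vcomp (?D (Suc i)) j X = X"
  proof
    fix k
    show "vcomp (?D (Suc i)) j X k = X k"
    proof (cases "c k = 0")
      case False
      then have "k < length (gen_degs F i)" "gen_degs F i ! k = j"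
        using cpart unfolding tensor_part_def free_rank_def by auto
      then show ?thesis by (simp add: vcomp_def X_def hcomp_homogeneous[of 0] homogeneous_single)
    qed (simp add: vcomp_def X_def)
  qed
  note hom = graded_mapD(4)[OF _ X, of _ _ j, unfolded this, symmetric]
  \<comment> \<open>All generators of \<open>L\<close> at this step have degree
    \<open>i + d\<close>, so an entry of the image has degree \<open>j - (i + d) \<noteq> 0\<close>
    and no constant term.\<close>
  have fX: "const_term (f (Suc i) X k) = 0" for k
  proof -
    have "f (Suc i) X k = vcomp (gen_degs L i) j (f (Suc i) X) k"
      using hom[OF f(2)[of "Suc i"]] by simp
    also have "const_term \<dots> = 0"
      using lin[of k i] j by (auto simp: vcomp_def const_term_hcomp free_rank_def)
    finally show ?thesis .
  qed
  have gfX: "const_term (g (Suc i) (f (Suc i) X) k) = 0" for k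
    by (rule graded_map_const_term[OF g(2) graded_mapD(1)[OF f(2) X] fX])
  \<comment> \<open>Since \<open>i\<close> is positive, \<open>?N i\<close> is a differential of
    \<open>F\<close> and not the augmentation, so the cycle condition on \<open>c\<close>
    applies.\<close>
  have "const_term (?N i X k) = 0" for k
    using fun_cong[OF tensor_diff_const_term[of F i' X], of k] cyc cX i' by simp
  then have hNX: "const_term (h i (?N i X) k) = 0" for k
    by (rule graded_map_const_term[OF h(1) graded_mapD(1)[OF graded_map_aug_diff[OF F] X]])
  have "c k = const_term (diff_map F i (h (Suc i) X) k)" for k
    using arg_cong[OF fun_cong[OF h(2)[OF X], of k], of const_term] gfX[of k] hNX[of k]
    by (simp add: const_term_add cX)
  then have "c = tensor_diff F i (\<lambda>k. const_term (h (Suc i) X k))"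
    unfolding tensor_diff_const_term by auto
  moreover have "(\<lambda>k. const_term (h (Suc i) X k)) \<in> tensor_part F (Suc i) j"
    by (rule const_term_tensor_part[of _ V])
      (use graded_mapD(1)[OF h(1) X] hom[OF h(1)[of "Suc i"]] in \<open>simp_all add: free_module_eq\<close>)
  ultimately show ?thesis unfolding tensor_boundaries_def by blast
qed

lemma tensor_cycles_diff:
  assumes "c \<in> tensor_cycles F i j" "c' \<in> tensor_cycles F i j"
  shows "(\<lambda>k. c k - c' k) \<in> tensor_cycles F i j"
proof -
  have "tensor_diff F i' (\<lambda>k. c k - c' k) = (\<lambda>k. tensor_diff F i' c k - tensor_diff F i' c' k)" for i'
    by (auto simp: tensor_diff_def right_diff_distrib sum_subtractf)
  moreover have "c k - c' k \<noteq> 0 \<Longrightarrow> c k \<noteq> 0 \<or> c' k \<noteq> 0" for k by auto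
  ultimately show ?thesis using assms unfolding tensor_cycles_def tensor_part_def by fastforce
qed

lemma is_singleton_tensor_homology:
  assumes F: "graded_free_resolution V J F" and L: "graded_free_resolution V J L"
    and lin: "\<And>i k. k < free_rank L i \<Longrightarrow> gen_degs L i ! k = int (i + d)"
    and i: "i \<ge> 1" and j: "j \<noteq> int (i + d)"
  shows "is_singleton (tensor_homology F i j)"
proof -
  let ?Z = "tensor_cycles F i j"
  have "(\<lambda>k. 0) \<in> ?Z" by (auto simp: tensor_cycles_def tensor_part_def tensor_diff_def)
  moreover have "{(c, c'). c \<in> ?Z \<and> c' \<in> ?Z \<and> (\<lambda>k. c k - c' k) \<in> tensor_boundaries F i j} = ?Z \<times> ?Z"
    using tensor_cycle_is_boundary[OF F L lin i j tensor_cycles_diff] by auto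
  ultimately have "tensor_homology F i j = {?Z}"
    unfolding tensor_homology_def quotient_def by auto
  then show ?thesis by simp
qed

section \<open>Linear resolutions\<close>

definition vecs :: "'v set \<Rightarrow> nat \<Rightarrow> (nat \<Rightarrow> ('v, 'k::field) mpoly) set" where
  "vecs V n = {x. (\<forall>k. x k \<in> poly_ring V) \<and> (\<forall>k\<ge>n. x k = 0)}"

definition comb ::
    "nat \<Rightarrow> (nat \<Rightarrow> nat \<Rightarrow> ('v, 'k::field) mpoly) \<Rightarrow> (nat \<Rightarrow> ('v, 'k) mpoly) \<Rightarrow> (nat \<Rightarrow> ('v, 'k) mpoly)" where
  "comb n g s = (\<lambda>k. \<Sum>i<n. s i * g i k)"

definition syzygies ::
    "'v set \<Rightarrow> nat \<Rightarrow> (nat \<Rightarrow> nat \<Rightarrow> ('v, 'k::field) mpoly) \<Rightarrow> (nat \<Rightarrow> ('v, 'k) mpoly) set" where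
  "syzygies V n g = {s \<in> vecs V n. comb n g s = (\<lambda>k. 0)}"

definition generators ::
    "'v set \<Rightarrow> int \<Rightarrow> nat \<Rightarrow> (nat \<Rightarrow> nat \<Rightarrow> ('v, 'k::field) mpoly) \<Rightarrow> bool" where
  "generators V e n g \<longleftrightarrow> (\<forall>i<n. \<forall>k. g i k \<in> poly_ring V \<and> homogeneous e (g i k))"

text \<open>Elements of a module are vectors of polynomials; \<open>linear_module V e M\<close> says that \<open>M\<close> is
  generated by vectors whose entries are forms of degree \<open>e\<close>, and that all matrices of
  a free resolution can be chosen with linear entries.\<close>

coinductive linear_module :: "'v set \<Rightarrow> int \<Rightarrow> (nat \<Rightarrow> ('v, 'k::field) mpoly) set \<Rightarrow> bool" for V where
  "generators V e n g \<Longrightarrow> linear_module V 1 (syzygies V n g) \<Longrightarrow>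
    linear_module V e (comb n g ` vecs V n)"

text \<open>One degree \<open>e\<close> is used in all coordinates: the ambient free module carries
  no shifts.\<close>

definition graded_submodule :: "'v set \<Rightarrow> (nat \<Rightarrow> ('v, 'k::field) mpoly) set \<Rightarrow> bool" where
  "graded_submodule V B \<longleftrightarrow> (\<lambda>k. 0) \<in> B \<and> (\<forall>x\<in>B. \<forall>k. x k \<in> poly_ring V) \<and>
     (\<forall>x\<in>B. \<forall>y\<in>B. (\<lambda>k. x k + y k) \<in> B) \<and> (\<forall>a\<in>poly_ring V. \<forall>x\<in>B. (\<lambda>k. a * x k) \<in> B) \<and>
     (\<forall>x\<in>B. \<forall>e. (\<lambda>k. hcomp e (x k)) \<in> B)"

lemma graded_submodule_sum:
  assumes B: "graded_submodule V B" and "finite I" "\<And>i. i \<in> I \<Longrightarrow> s i \<in> poly_ring V" "\<And>i. i \<in> I \<Longrightarrow> g i \<in> B"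
  shows "(\<lambda>k. \<Sum>i\<in>I. s i * g i k) \<in> B"
  using assms(2-4)
proof (induction I)
  case (insert i I)
  then have "(\<lambda>k. s i * g i k) \<in> B" "(\<lambda>k. \<Sum>i\<in>I. s i * g i k) \<in> B"
    using B unfolding graded_submodule_def by auto
  then show ?case using B insert.hyps unfolding graded_submodule_def by simp
qed (use B in \<open>simp add: graded_submodule_def\<close>)

lemma graded_submodule_comb:
  assumes "graded_submodule V B" "s \<in> vecs V n" "\<And>i. i < n \<Longrightarrow> g i \<in> B"
  shows "comb n g s \<in> B"
  unfolding comb_def by (rule graded_submodule_sum[OF assms(1)]) (use assms in \<open>auto simp: vecs_def\<close>)

lemma graded_submodule_uminus:
  assumes "graded_submodule V B" "x \<in> B"
  shows "(\<lambda>k. - x k) \<in> B"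
proof -
  have "(\<lambda>k. (- 1) * x k) \<in> B" using assms unfolding graded_submodule_def by (metis one_poly_ring uminus_poly_ring)
  then show ?thesis by simp
qed

lemma graded_submodule_diff:
  assumes "graded_submodule V B" "x \<in> B" "y \<in> B"
  shows "(\<lambda>k. x k - y k) \<in> B"
proof -
  have "\<forall>x\<in>B. \<forall>y\<in>B. (\<lambda>k. x k + y k) \<in> B" using assms(1) unfolding graded_submodule_def by simp
  from bspec[OF bspec[OF this assms(2)] graded_submodule_uminus[OF assms(1,3)]]
  show ?thesis by simp
qed

text \<open>Closure under components holds because all generators have the same degree
  \<open>e\<close>.\<close>

lemma graded_submodule_syzygies:
  assumes g: "generators V e n g"
  shows "graded_submodule V (syzygies V n g)"
  unfolding graded_submodule_def
proof (intro conjI ballI allI)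
  fix x assume x: "x \<in> syzygies V n g"
  then have x': "(\<Sum>i<n. x i * g i k) = 0" "x k \<in> poly_ring V" for k
    by (auto simp: syzygies_def comb_def fun_eq_iff vecs_def)
  show "x k \<in> poly_ring V" for k by (rule x')
  show "(\<lambda>k. hcomp j (x k)) \<in> syzygies V n g" for j
  proof -
    have "(\<Sum>i<n. hcomp j (x i) * g i k) = hcomp (j + e) (\<Sum>i<n. x i * g i k)" for k
      using g by (auto simp: hcomp_sum generators_def hcomp_mult[of e] intro!: sum.cong)
    then show ?thesis using x x' by (simp add: syzygies_def comb_def vecs_def)
  qed
  show "(\<lambda>k. a * x k) \<in> syzygies V n g" if "a \<in> poly_ring V" for a
  proof -
    have "(\<Sum>i<n. a * x i * g i k) = a * (\<Sum>i<n. x i * g i k)" for k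
      by (simp add: sum_distrib_left mult.assoc)
    then show ?thesis using x x' that by (simp add: syzygies_def comb_def vecs_def)
  qed
  show "(\<lambda>k. x k + y k) \<in> syzygies V n g" if "y \<in> syzygies V n g" for y
    using x that by (auto simp: syzygies_def comb_def vecs_def fun_eq_iff distrib_right sum.distrib)
qed (auto simp: syzygies_def comb_def vecs_def)

text \<open>Zero generators suffice, and their syzygy module is again zero, which closes the
  coinduction.\<close>

lemma linear_module_zero: "linear_module V e {\<lambda>k. 0}"
proof -
  have "linear_module V e M" if "M = {\<lambda>k. 0}" for M :: "(nat \<Rightarrow> ('a, 'b) mpoly) set"
    using that
  proof (coinduction arbitrary: e M)
    case (linear_module e M)
    have "vecs V 0 = M" using linear_module by (auto simp: vecs_def)
    then have "M = comb 0 (\<lambda>_ _. 0) ` vecs V 0" "syzygies V 0 (\<lambda>_ _. 0) = M"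
      using linear_module by (auto simp: comb_def syzygies_def)
    then show ?case
      using linear_module
      by (intro exI[of _ e] exI[of _ 0] exI[of _ "\<lambda>_ _. 0"]) (auto simp: generators_def)
  qed
  then show ?thesis by simp
qed

lemma comb_mem: "i < n \<Longrightarrow> g i \<in> comb n g ` vecs V n"
  by (rule image_eqI[of _ _ "\<lambda>k. if k = i then 1 else 0"])
    (auto simp: comb_def vecs_def if_distrib[of "\<lambda>x. x * _"] cong: if_cong)

lemma sum_split_add:
  fixes F :: "nat \<Rightarrow> 'a::comm_monoid_add"
  shows "(\<Sum>i<p + q. F i) = (\<Sum>i<p. F i) + (\<Sum>i<q. F (i + p))"
  by (induction q) (simp_all add: ac_simps)

text \<open>The horseshoe lemma: a resolution of \<open>B\<close> is assembled from one of the submodule of vectors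
  supported on the first \<open>k\<close> coordinates and one of its projection to the others; the syzygies of
  the combined generators are again such an extension, so coinduction applies.\<close>

lemma linear_module_extension:
  assumes "graded_submodule V B"
    and "linear_module V 1 {x \<in> B. \<forall>i\<ge>k. x i = 0}"
    and "linear_module V 1 ((\<lambda>x i. x (i + k)) ` B)"
  shows "linear_module V 1 B"
  using assms
proof (coinduction arbitrary: B k)
  case (linear_module B k)
  note B = linear_module(1)
  from linear_module(2) obtain p a where A: "{x \<in> B. \<forall>i\<ge>k. x i = 0} = comb p a ` vecs V p"
    "generators V 1 p a" "linear_module V 1 (syzygies V p a)"
    by (cases rule: linear_module.cases) auto
  from linear_module(3) obtain q c where C: "(\<lambda>x i. x (i + k)) ` B = comb q c ` vecs V q"
    "generators V 1 q c" "linear_module V 1 (syzygies V q c)"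
    by (cases rule: linear_module.cases) auto
  have a: "a i \<in> B" "\<And>j. j \<ge> k \<Longrightarrow> a i j = 0" if "i < p" for i
    using comb_mem[OF that, of a V] A(1) by auto
  \<comment> \<open>An arbitrary lift of \<open>c i\<close> need not be linear in the first
    \<open>k\<close> coordinates; its component of degree 1 is, still lies in \<open>B\<close>, and
    still projects to \<open>c i\<close>.\<close>
  have "\<exists>b\<in>B. (\<forall>j. homogeneous 1 (b j)) \<and> (\<lambda>j. b (j + k)) = c i" if i: "i < q" for i
  proof -
    have "c i \<in> (\<lambda>x i. x (i + k)) ` B" unfolding C(1) by (rule comb_mem[OF i])
    then obtain b where b: "b \<in> B" "(\<lambda>j. b (j + k)) = c i" by auto
    have "(\<lambda>j. hcomp 1 (b j)) \<in> B" using B b(1) unfolding graded_submodule_def by blast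
    moreover have "hcomp 1 (b (j + k)) = c i j" for j
      using fun_cong[OF b(2), of j] C(2) i by (simp add: generators_def hcomp_homogeneous[of 1])
    ultimately show ?thesis by (intro bexI[of _ "\<lambda>j. hcomp 1 (b j)"]) auto
  qed
  then have "\<forall>i. \<exists>b. i < q \<longrightarrow> b \<in> B \<and> (\<forall>j. homogeneous 1 (b j)) \<and> (\<lambda>j. b (j + k)) = c i"
    by blast
  from choice[OF this] obtain b where
    b': "\<forall>i. i < q \<longrightarrow> b i \<in> B \<and> (\<forall>j. homogeneous 1 (b i j)) \<and> (\<lambda>j. b i (j + k)) = c i"
    by blast
  then have b: "\<And>i. i < q \<Longrightarrow> b i \<in> B" "\<And>i j. i < q \<Longrightarrow> homogeneous 1 (b i j)"
      "\<And>i j. i < q \<Longrightarrow> b i (j + k) = c i j"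
    by (simp_all add: fun_eq_iff)
  define g where "g = (\<lambda>i. if i < p then a i else b (i - p))"
  define join where "join = (\<lambda>(t :: nat \<Rightarrow> ('a, 'b) mpoly) s i. if i < p then t i else s (i - p))"
  have comb_g: "comb (p + q) g s = (\<lambda>j. comb p a s j + comb q b (\<lambda>i. s (i + p)) j)" for s
    by (simp add: comb_def g_def sum_split_add)
  have join: "comb p a (join t s) = comb p a t" "(\<lambda>i. join t s (i + p)) = s" for t s
    by (auto simp: comb_def join_def)
  have join_vecs: "join t s \<in> vecs V (p + q)" if "t \<in> vecs V p" "s \<in> vecs V q" for t s
    using that by (auto simp: join_def vecs_def)
  have gens: "generators V 1 (p + q) g"
    unfolding generators_def
  proof (intro allI impI)
    fix i j assume "i < p + q"
    then show "g i j \<in> poly_ring V \<and> homogeneous 1 (g i j)"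
      using a(1)[of i] A(2) b(1,2)[of "i - p"] B
      by (auto simp: g_def generators_def graded_submodule_def)
  qed
  have gB: "g i \<in> B" if "i < p + q" for i
    using that a(1) b(1) by (auto simp: g_def)
  have shift_vecs: "(\<lambda>i. s (i + p)) \<in> vecs V q" if "s \<in> vecs V (p + q)" for s
    using that by (auto simp: vecs_def)
  have comb_a_high: "comb p a s j = 0" if "j \<ge> k" for s j
    using a(2) that by (simp add: comb_def)
  have comb_b_shift: "comb q b s (j + k) = comb q c s j" for s j
    using b(3) by (simp add: comb_def)
  have lift: "\<exists>t\<in>vecs V p. comb p a t = x" if "x \<in> B" "\<And>j. x (j + k) = 0" for x
  proof -
    have "x j = 0" if "j \<ge> k" for j using \<open>\<And>j. x (j + k) = 0\<close>[of "j - k"] that by simp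
    then have "x \<in> comb p a ` vecs V p" using A(1) that(1) by blast
    then show ?thesis by auto
  qed
  have image: "B = comb (p + q) g ` vecs V (p + q)"
  proof
    show "comb (p + q) g ` vecs V (p + q) \<subseteq> B"
      using graded_submodule_comb[OF B _ gB] by auto
    show "B \<subseteq> comb (p + q) g ` vecs V (p + q)"
    proof
      fix x assume x: "x \<in> B"
      then have "(\<lambda>i. x (i + k)) \<in> comb q c ` vecs V q" using C(1) by blast
      then obtain s where s: "s \<in> vecs V q" "(\<lambda>i. x (i + k)) = comb q c s" by auto
      have "(\<lambda>j. x j - comb q b s j) \<in> B"
        by (rule graded_submodule_diff[OF B x graded_submodule_comb[OF B s(1) b(1)]])
      moreover have "x (j + k) - comb q b s (j + k) = 0" for j
        using fun_cong[OF s(2), of j] comb_b_shift by simp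
      ultimately obtain t where t: "t \<in> vecs V p" "comb p a t = (\<lambda>j. x j - comb q b s j)"
        using lift by blast
      have "x = comb (p + q) g (join t s)"
        unfolding comb_g join t(2) by simp
      then show "x \<in> comb (p + q) g ` vecs V (p + q)" using join_vecs t(1) s(1) by blast
    qed
  qed
  have low: "{x \<in> syzygies V (p + q) g. \<forall>i\<ge>p. x i = 0} = syzygies V p a"
  proof -
    have "comb (p + q) g s = comb p a s" if "\<forall>i\<ge>p. s i = 0" for s
      using that unfolding comb_g by (simp add: comb_def)
    then show ?thesis by (auto simp: syzygies_def vecs_def)
  qed
  have high: "(\<lambda>x i. x (i + p)) ` syzygies V (p + q) g = syzygies V q c"
  proof
    show "(\<lambda>x i. x (i + p)) ` syzygies V (p + q) g \<subseteq> syzygies V q c"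
    proof (clarsimp simp: syzygies_def shift_vecs)
      fix s assume "s \<in> vecs V (p + q)" and "comb (p + q) g s = (\<lambda>k. 0)"
      then have "comb p a s (j + k) + comb q b (\<lambda>i. s (i + p)) (j + k) = 0" for j
        unfolding comb_g by meson
      then show "comb q c (\<lambda>i. s (i + p)) = (\<lambda>k. 0)"
        by (simp add: comb_a_high comb_b_shift fun_eq_iff)
    qed
    show "syzygies V q c \<subseteq> (\<lambda>x i. x (i + p)) ` syzygies V (p + q) g"
    proof
      fix s assume s: "s \<in> syzygies V q c"
      then have sv: "s \<in> vecs V q" by (simp add: syzygies_def)
      \<comment> \<open>For a syzygy \<open>s\<close> of the projected generators, the combination
        of their lifts lives in the first \<open>k\<close> coordinates, so the generators
        \<open>a\<close> can cancel it.\<close>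
      have "comb q b s (j + k) = 0" for j
        using s comb_b_shift by (simp add: syzygies_def)
      moreover have "comb q b s \<in> B" by (rule graded_submodule_comb[OF B sv b(1)])
      ultimately obtain t where t: "t \<in> vecs V p" "comb p a t = comb q b s"
        using lift[of "comb q b s"] by blast
      have "(\<lambda>i. - t i) \<in> vecs V p" using t(1) by (simp add: vecs_def)
      moreover have "comb p a (\<lambda>i. - t i) = (\<lambda>j. - comb q b s j)"
        unfolding t(2)[symmetric] by (simp add: comb_def sum_negf)
      ultimately have "join (\<lambda>i. - t i) s \<in> syzygies V (p + q) g"
        using join_vecs[OF _ sv] by (simp add: syzygies_def comb_g join)
      then show "s \<in> (\<lambda>x i. x (i + p)) ` syzygies V (p + q) g"
        by (rule image_eqI[rotated]) (simp add: join(2))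
    qed
  qed
  show ?case
  proof (intro exI conjI)
    show "(1 :: int) = 1" "B = comb (p + q) g ` vecs V (p + q)" "generators V 1 (p + q) g"
      by (fact refl image gens)+
    have "graded_submodule V (syzygies V (p + q) g) \<and>
      linear_module V 1 {x \<in> syzygies V (p + q) g. \<forall>i\<ge>p. x i = 0} \<and>
      linear_module V 1 ((\<lambda>x i. x (i + p)) ` syzygies V (p + q) g)"
      unfolding low high using graded_submodule_syzygies[OF gens] A(3) C(3) by blast
    then show "(\<exists>B k. 1 = (1 :: int) \<and> syzygies V (p + q) g = B \<and> graded_submodule V B \<and>
        linear_module V 1 {x \<in> B. \<forall>i\<ge>k. x i = 0} \<and> linear_module V 1 ((\<lambda>x i. x (i + k)) ` B)) \<or>
        linear_module V 1 (syzygies V (p + q) g)"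
      by blast
  qed
qed

text \<open>Ideals enter the module formalism as vectors supported on coordinate 0.\<close>

definition ideal_vecs :: "('v, 'k::field) mpoly set \<Rightarrow> (nat \<Rightarrow> ('v, 'k) mpoly) set" where
  "ideal_vecs I = (\<lambda>p k. if k = 0 then p else 0) ` I"

text \<open>Adjoin \<open>u\<close> as last generator. The syzygies with last entry 0 are those of
  the old generators, and the last entries of all syzygies form the colon ideal of \<open>I\<close>
  by \<open>u\<close>, so the horseshoe step applies with \<open>k = n\<close>.\<close>

lemma linear_module_add_generator:
  assumes I: "linear_module V d (ideal_vecs I)"
    and u: "u \<in> poly_ring V" "homogeneous d u"
    and colon: "linear_module V 1 (ideal_vecs {p \<in> poly_ring V. p * u \<in> I})"
  shows "linear_module V d (ideal_vecs {q + p * u |q p. q \<in> I \<and> p \<in> poly_ring V})"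
proof -
  from I obtain n a where A: "ideal_vecs I = comb n a ` vecs V n"
    "generators V d n a" "linear_module V 1 (syzygies V n a)"
    by (cases rule: linear_module.cases) auto
  define g where "g = (\<lambda>i. if i < n then a i else (\<lambda>k. if k = 0 then u else 0))"
  have gens: "generators V d (Suc n) g" using A(2) u by (auto simp: generators_def g_def)
  have comb_g: "comb (Suc n) g s = (\<lambda>k. comb n a s k + (if k = 0 then s n * u else 0))" for s
    by (auto simp: comb_def g_def fun_eq_iff)
  have comb_cong: "comb n a s = comb n a s'" if "\<And>i. i < n \<Longrightarrow> s i = s' i" for s s'
    using that by (simp add: comb_def)
  define join where "join = (\<lambda>(t :: nat \<Rightarrow> ('a, 'b) mpoly) p i. if i < n then t i else if i = n then p else 0)"
  have join: "comb n a (join t p) = comb n a t" "join t p n = p" for t p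
    by (auto simp: join_def intro: comb_cong)
  have join_vecs: "join t p \<in> vecs V (Suc n)" if "t \<in> vecs V n" "p \<in> poly_ring V" for t p
    using that by (auto simp: join_def vecs_def)
  have repr: "\<exists>t\<in>vecs V n. comb n a t = (\<lambda>k. if k = 0 then r else 0)" if "r \<in> I" for r
  proof -
    have "(\<lambda>k. if k = 0 then r else 0) \<in> comb n a ` vecs V n"
      using that unfolding A(1)[symmetric] ideal_vecs_def by blast
    then show ?thesis by auto
  qed
  have restrict: "comb n a s \<in> ideal_vecs I" if "s \<in> vecs V (Suc n)" for s
  proof -
    have "(\<lambda>i. if i < n then s i else 0) \<in> vecs V n" using that by (auto simp: vecs_def)
    moreover have "comb n a s = comb n a (\<lambda>i. if i < n then s i else 0)" by (rule comb_cong) simp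
    ultimately show ?thesis using A(1) by blast
  qed
  have "linear_module V 1 (syzygies V (Suc n) g)"
  proof (rule linear_module_extension[OF graded_submodule_syzygies[OF gens], of n])
    have "comb (Suc n) g s = comb n a s" if "s n = 0" for s
      by (rule ext) (simp add: comb_g that)
    then have "{x \<in> syzygies V (Suc n) g. \<forall>i\<ge>n. x i = 0} = syzygies V n a"
      by (auto simp: syzygies_def vecs_def)
    then show "linear_module V 1 {x \<in> syzygies V (Suc n) g. \<forall>i\<ge>n. x i = 0}" using A(3) by simp
    have "(\<lambda>x i. x (i + n)) ` syzygies V (Suc n) g = ideal_vecs {p \<in> poly_ring V. p * u \<in> I}"
    proof
      show "(\<lambda>x i. x (i + n)) ` syzygies V (Suc n) g \<subseteq> ideal_vecs {p \<in> poly_ring V. p * u \<in> I}"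
      proof
        fix y assume "y \<in> (\<lambda>x i. x (i + n)) ` syzygies V (Suc n) g"
        then obtain x where x: "x \<in> vecs V (Suc n)" "comb (Suc n) g x = (\<lambda>k. 0)" "y = (\<lambda>i. x (i + n))"
          by (auto simp: syzygies_def)
        obtain r where r: "r \<in> I" "comb n a x = (\<lambda>k. if k = 0 then r else 0)"
          using restrict[OF x(1)] by (auto simp: ideal_vecs_def)
        \<comment> \<open>Here \<open>I\<close> is only a set whose vectors are the combinations of
          \<open>a\<close>; that it contains \<open>- r\<close> is read off from the negated
          coefficients.\<close>
        obtain r' where r': "r' \<in> I" "comb n a (\<lambda>i. - (if i < n then x i else 0)) = (\<lambda>k. if k = 0 then r' else 0)"
          using restrict[of "\<lambda>i. - (if i < n then x i else 0)"] x(1) by (auto simp: ideal_vecs_def vecs_def)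
        have "comb n a (\<lambda>i. - (if i < n then x i else 0)) = (\<lambda>k. - comb n a x k)"
          by (auto simp: comb_def sum_negf[symmetric] intro!: sum.cong)
        then have "r' = - r" using r(2) r'(2) by (auto dest: fun_cong[of _ _ 0])
        moreover have "r + x n * u = 0" using fun_cong[OF x(2), of 0] r(2) by (simp add: comb_g)
        ultimately have "x n * u \<in> I" using r'(1) by (metis add.commute eq_neg_iff_add_eq_0)
        moreover have "y = (\<lambda>k. if k = 0 then x n else 0)" using x by (auto simp: vecs_def fun_eq_iff)
        ultimately show "y \<in> ideal_vecs {p \<in> poly_ring V. p * u \<in> I}"
          using x(1) by (auto simp: ideal_vecs_def vecs_def)
      qed
      show "ideal_vecs {p \<in> poly_ring V. p * u \<in> I} \<subseteq> (\<lambda>x i. x (i + n)) ` syzygies V (Suc n) g"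
      proof
        fix y assume "y \<in> ideal_vecs {p \<in> poly_ring V. p * u \<in> I}"
        then obtain p where p: "p \<in> poly_ring V" "p * u \<in> I" "y = (\<lambda>k. if k = 0 then p else 0)"
          by (auto simp: ideal_vecs_def)
        obtain t where t: "t \<in> vecs V n" "comb n a t = (\<lambda>k. if k = 0 then p * u else 0)"
          using repr[OF p(2)] by blast
        have "comb n a (\<lambda>i. - t i) = (\<lambda>k. - comb n a t k)"
          by (simp add: comb_def sum_negf)
        moreover have "(\<lambda>i. - t i) \<in> vecs V n" using t(1) by (simp add: vecs_def)
        ultimately have "join (\<lambda>i. - t i) p \<in> syzygies V (Suc n) g"
          using join_vecs[OF _ p(1)] t(2) by (auto simp: syzygies_def comb_g join)
        moreover have "y = (\<lambda>i. join (\<lambda>i. - t i) p (i + n))" by (auto simp: p(3) join_def)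
        ultimately show "y \<in> (\<lambda>x i. x (i + n)) ` syzygies V (Suc n) g" by blast
      qed
    qed
    then show "linear_module V 1 ((\<lambda>x i. x (i + n)) ` syzygies V (Suc n) g)" using colon by simp
  qed
  from linear_module.intros[OF gens this]
  have "linear_module V d (comb (Suc n) g ` vecs V (Suc n))" .
  moreover have "comb (Suc n) g ` vecs V (Suc n) = ideal_vecs {q + p * u |q p. q \<in> I \<and> p \<in> poly_ring V}"
  proof
    show "comb (Suc n) g ` vecs V (Suc n) \<subseteq> ideal_vecs {q + p * u |q p. q \<in> I \<and> p \<in> poly_ring V}"
    proof
      fix y assume "y \<in> comb (Suc n) g ` vecs V (Suc n)"
      then obtain s where s: "s \<in> vecs V (Suc n)" "y = comb (Suc n) g s" by auto
      obtain r where "r \<in> I" "comb n a s = (\<lambda>k. if k = 0 then r else 0)"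
        using restrict[OF s(1)] by (auto simp: ideal_vecs_def)
      then show "y \<in> ideal_vecs {q + p * u |q p. q \<in> I \<and> p \<in> poly_ring V}"
        using s unfolding ideal_vecs_def comb_g
        by (intro image_eqI[of _ _ "r + s n * u"]) (auto simp: vecs_def)
    qed
    show "ideal_vecs {q + p * u |q p. q \<in> I \<and> p \<in> poly_ring V} \<subseteq> comb (Suc n) g ` vecs V (Suc n)"
    proof
      fix y assume "y \<in> ideal_vecs {q + p * u |q p. q \<in> I \<and> p \<in> poly_ring V}"
      then obtain q p where y: "q \<in> I" "p \<in> poly_ring V" "y = (\<lambda>k. if k = 0 then q + p * u else 0)"
        by (auto simp: ideal_vecs_def)
      obtain t where t: "t \<in> vecs V n" "comb n a t = (\<lambda>k. if k = 0 then q else 0)"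
        using repr[OF y(1)] by blast
      have "y = comb (Suc n) g (join t p)" using t(2) by (auto simp: y(3) comb_g join)
      then show "y \<in> comb (Suc n) g ` vecs V (Suc n)" using join_vecs[OF t(1) y(2)] by blast
    qed
  qed
  ultimately show ?thesis by simp
qed

section \<open>Monomial ideals\<close>

definition mdvd :: "('v \<Rightarrow>\<^sub>0 nat) \<Rightarrow> ('v \<Rightarrow>\<^sub>0 nat) \<Rightarrow> bool" where
  "mdvd u m \<longleftrightarrow> (\<forall>v. Poly_Mapping.lookup u v \<le> Poly_Mapping.lookup m v)"

text \<open>A description by supports, which turns membership and colons into statements about
  exponents.\<close>

definition monomial_ideal :: "'v set \<Rightarrow> ('v \<Rightarrow>\<^sub>0 nat) set \<Rightarrow> ('v, 'k::field) mpoly set" where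
  "monomial_ideal V M = {p \<in> poly_ring V. \<forall>m\<in>Poly_Mapping.keys p. \<exists>u\<in>M. mdvd u m}"

lemma mdvd_add: "mdvd u (m + u)"
  by (simp add: mdvd_def lookup_add)

lemma mdvd_diff_add: "mdvd u m \<Longrightarrow> m - u + u = m"
  by (rule poly_mapping_eqI) (simp add: mdvd_def lookup_add lookup_minus)

lemma keys_diff_subset: "Poly_Mapping.keys (m - u) \<subseteq> Poly_Mapping.keys (m :: 'v \<Rightarrow>\<^sub>0 nat)"
  by (auto simp: in_keys_iff lookup_minus)

lemma poly_mapping_sum_single:
  "(\<Sum>m\<in>Poly_Mapping.keys p. Poly_Mapping.single m (Poly_Mapping.lookup p m)) = p"
proof (rule poly_mapping_eqI)
  fix k
  show "Poly_Mapping.lookup (\<Sum>m\<in>Poly_Mapping.keys p. Poly_Mapping.single m (Poly_Mapping.lookup p m)) k =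
      Poly_Mapping.lookup p k"
    by (simp add: lookup_sum lookup_single when_def in_keys_iff)
qed

lemma monomial_ideal_zero: "0 \<in> monomial_ideal V M"
  by (simp add: monomial_ideal_def)

lemma monomial_ideal_add:
  "p \<in> monomial_ideal V M \<Longrightarrow> q \<in> monomial_ideal V M \<Longrightarrow> p + q \<in> monomial_ideal V M"
  using Poly_Mapping.keys_add[of p q] unfolding monomial_ideal_def by auto

lemma monomial_ideal_sum:
  "(\<And>i. i \<in> I \<Longrightarrow> f i \<in> monomial_ideal V M) \<Longrightarrow> (\<Sum>i\<in>I. f i) \<in> monomial_ideal V M"
  by (induction I rule: infinite_finite_induct) (auto simp: monomial_ideal_zero monomial_ideal_add)

lemma monomial_ideal_mono: "M \<subseteq> M' \<Longrightarrow> monomial_ideal V M \<subseteq> monomial_ideal V M'"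
  unfolding monomial_ideal_def by blast

lemma single_in_monomial_ideal:
  "u \<in> M \<Longrightarrow> mdvd u m \<Longrightarrow> Poly_Mapping.keys m \<subseteq> V \<Longrightarrow> Poly_Mapping.single m c \<in> monomial_ideal V M"
  by (auto simp: monomial_ideal_def)

lemma mult_single_in_monomial_ideal:
  assumes "p \<in> poly_ring V" "u \<in> M" "Poly_Mapping.keys u \<subseteq> V"
  shows "p * Poly_Mapping.single u 1 \<in> monomial_ideal V M"
proof -
  have "\<exists>u\<in>M. mdvd u m" if m: "m \<in> Poly_Mapping.keys (p * Poly_Mapping.single u 1)" for m
  proof -
    obtain a where "m = a + u"
      using subsetD[OF Poly_Mapping.keys_mult m] by (auto split: if_splits)
    then show ?thesis using assms(2) mdvd_add by blast
  qed
  then show ?thesis using assms by (simp add: monomial_ideal_def)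
qed

lemma ideal_generated_monomials:
  assumes "\<And>u. u \<in> M \<Longrightarrow> Poly_Mapping.keys u \<subseteq> V"
  shows "ideal_generated V ((\<lambda>u. Poly_Mapping.single u 1) ` M) = (monomial_ideal V M :: ('v, 'k::field) mpoly set)"
proof
  let ?s = "\<lambda>u :: 'v \<Rightarrow>\<^sub>0 nat. Poly_Mapping.single u (1 :: 'k)"
  show "ideal_generated V (?s ` M) \<subseteq> monomial_ideal V M"
    unfolding ideal_generated_def
    by (auto intro!: monomial_ideal_sum mult_single_in_monomial_ideal dest: assms subsetD)
  show "monomial_ideal V M \<subseteq> ideal_generated V (?s ` M)"
  proof
    fix p :: "('v, 'k) mpoly" assume p: "p \<in> monomial_ideal V M"
    then have "\<forall>m\<in>Poly_Mapping.keys p. \<exists>u. u \<in> M \<and> mdvd u m" by (auto simp: monomial_ideal_def)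
    from bchoice[OF this] obtain u where u: "\<And>m. m \<in> Poly_Mapping.keys p \<Longrightarrow> u m \<in> M \<and> mdvd (u m) m" by auto
    define T where "T = (\<lambda>m. ?s (u m)) ` Poly_Mapping.keys p"
    \<comment> \<open>Several terms of \<open>p\<close> may use the same generator, whereas
      \<open>ideal_generated\<close> allows one coefficient per generator; the quotients are
      therefore grouped.\<close>
    define q where "q = (\<lambda>b. \<Sum>m\<in>{m \<in> Poly_Mapping.keys p. ?s (u m) = b}.
      Poly_Mapping.single (m - u m) (Poly_Mapping.lookup p m))"
    have "(\<Sum>b\<in>T. q b * b) =
        (\<Sum>b\<in>T. \<Sum>m\<in>{m \<in> Poly_Mapping.keys p. ?s (u m) = b}.
          Poly_Mapping.single (m - u m) (Poly_Mapping.lookup p m) * ?s (u m))"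
      unfolding q_def sum_distrib_right by (intro sum.cong) auto
    also have "\<dots> = (\<Sum>m\<in>Poly_Mapping.keys p. Poly_Mapping.single (m - u m) (Poly_Mapping.lookup p m) * ?s (u m))"
      by (rule sum.group) (auto simp: T_def)
    also have "\<dots> = (\<Sum>m\<in>Poly_Mapping.keys p. Poly_Mapping.single m (Poly_Mapping.lookup p m))"
      by (rule sum.cong) (use u in \<open>auto simp: mult_single mdvd_diff_add\<close>)
    finally have "p = (\<Sum>b\<in>T. q b * b)" by (simp add: poly_mapping_sum_single)
    moreover have "q b \<in> poly_ring V" for b
      unfolding q_def using p keys_diff_subset
      by (intro sum_poly_ring single_poly_ring) (fastforce simp: monomial_ideal_def poly_ring_def)
    moreover have "finite T" "T \<subseteq> ?s ` M" using u by (auto simp: T_def)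
    ultimately show "p \<in> ideal_generated V (?s ` M)" unfolding ideal_generated_def by blast
  qed
qed

text \<open>Terms divisible by an element of \<open>M\<close> go into \<open>q\<close>; every other
  term is divisible by \<open>u\<close>, and its quotient goes into \<open>p\<close>.\<close>

lemma monomial_ideal_insert:
  fixes V :: "'v set"
  assumes u: "Poly_Mapping.keys u \<subseteq> V"
  shows "(monomial_ideal V (insert u M) :: ('v, 'k::field) mpoly set) =
    {q + p * Poly_Mapping.single u 1 |q p. q \<in> monomial_ideal V M \<and> p \<in> poly_ring V}"
proof
  show "{q + p * Poly_Mapping.single u 1 |q p. q \<in> monomial_ideal V M \<and> p \<in> poly_ring V} \<subseteq>
      (monomial_ideal V (insert u M) :: ('v, 'k) mpoly set)"
  proof clarify
    fix q p :: "('v, 'k) mpoly" assume "q \<in> monomial_ideal V M" "p \<in> poly_ring V"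
    then show "q + p * Poly_Mapping.single u 1 \<in> monomial_ideal V (insert u M)"
      by (intro monomial_ideal_add subsetD[OF monomial_ideal_mono[OF subset_insertI]]
          mult_single_in_monomial_ideal[OF _ insertI1 u])
  qed
  show "(monomial_ideal V (insert u M) :: ('v, 'k) mpoly set) \<subseteq>
    {q + p * Poly_Mapping.single u 1 |q p. q \<in> monomial_ideal V M \<and> p \<in> poly_ring V}"
  proof
    fix x :: "('v, 'k) mpoly" assume x: "x \<in> monomial_ideal V (insert u M)"
    define K where "K = {m \<in> Poly_Mapping.keys x. \<exists>u'\<in>M. mdvd u' m}"
    define q where "q = (\<Sum>m\<in>K. Poly_Mapping.single m (Poly_Mapping.lookup x m))"
    define p where "p = (\<Sum>m\<in>Poly_Mapping.keys x - K. Poly_Mapping.single (m - u) (Poly_Mapping.lookup x m))"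
    have V: "Poly_Mapping.keys m \<subseteq> V" if "m \<in> Poly_Mapping.keys x" for m
      using x that by (auto simp: monomial_ideal_def poly_ring_def)
    have "q \<in> monomial_ideal V M"
      unfolding q_def
    proof (rule monomial_ideal_sum)
      fix m assume "m \<in> K"
      then show "Poly_Mapping.single m (Poly_Mapping.lookup x m) \<in> monomial_ideal V M"
        using V[of m] single_in_monomial_ideal[of _ M m V] by (auto simp: K_def)
    qed
    moreover have "p \<in> poly_ring V"
      unfolding p_def
    proof (intro sum_poly_ring single_poly_ring)
      fix m assume "m \<in> Poly_Mapping.keys x - K"
      then show "Poly_Mapping.keys (m - u) \<subseteq> V" using V[of m] keys_diff_subset[of m u] by auto
    qed
    moreover have "mdvd u m" if "m \<in> Poly_Mapping.keys x - K" for m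
      using x that by (auto simp: monomial_ideal_def K_def)
    then have "p * Poly_Mapping.single u 1 = (\<Sum>m\<in>Poly_Mapping.keys x - K. Poly_Mapping.single m (Poly_Mapping.lookup x m))"
      unfolding p_def sum_distrib_right by (intro sum.cong) (auto simp: mult_single mdvd_diff_add)
    then have "q + p * Poly_Mapping.single u 1 = x"
      unfolding q_def using sum.subset_diff[of K "Poly_Mapping.keys x" "\<lambda>m. Poly_Mapping.single m (Poly_Mapping.lookup x m)"]
      using poly_mapping_sum_single[of x] by (auto simp: K_def add.commute)
    ultimately show "x \<in> {q + p * Poly_Mapping.single u 1 |q p. q \<in> monomial_ideal V M \<and> p \<in> poly_ring V}"
      by blast
  qed
qed

lemma keys_mult_single:
  fixes p :: "('v, 'k::field) mpoly"
  shows "Poly_Mapping.keys (p * Poly_Mapping.single u 1) = (\<lambda>m. m + u) ` Poly_Mapping.keys p"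
proof -
  have "p * Poly_Mapping.single u 1 =
      (\<Sum>m\<in>Poly_Mapping.keys p. Poly_Mapping.single m (Poly_Mapping.lookup p m)) * Poly_Mapping.single u 1"
    by (simp add: poly_mapping_sum_single)
  also have "\<dots> = (\<Sum>m\<in>Poly_Mapping.keys p. Poly_Mapping.single (m + u) (Poly_Mapping.lookup p m))"
    by (simp add: sum_distrib_right mult_single)
  finally have *: "p * Poly_Mapping.single u 1 = (\<Sum>m\<in>Poly_Mapping.keys p. Poly_Mapping.single (m + u) (Poly_Mapping.lookup p m))" .
  have "Poly_Mapping.lookup (p * Poly_Mapping.single u 1) (m + u) = Poly_Mapping.lookup p m" for m
    by (simp add: * lookup_sum lookup_single when_def in_keys_iff)
  then have "m + u \<in> Poly_Mapping.keys (p * Poly_Mapping.single u 1)" if "m \<in> Poly_Mapping.keys p" for m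
    using that by (simp add: in_keys_iff)
  then show ?thesis
    using Poly_Mapping.keys_mult[of p "Poly_Mapping.single u 1"] by (auto split: if_splits)
qed

lemma colon_monomial_ideal:
  assumes "Poly_Mapping.keys u \<subseteq> V"
  shows "{p \<in> poly_ring V. p * Poly_Mapping.single u 1 \<in> monomial_ideal V M} =
    {p \<in> poly_ring V. \<forall>m\<in>Poly_Mapping.keys p. \<exists>u'\<in>M. mdvd u' (m + u)}"
  using assms by (auto simp: monomial_ideal_def keys_mult_single)

definition squarefree_monomial :: "'v set \<Rightarrow> ('v \<Rightarrow>\<^sub>0 nat)" where
  "squarefree_monomial W = (\<Sum>v\<in>W. Poly_Mapping.single v 1)"

lemma lookup_squarefree_monomial:
  "finite W \<Longrightarrow> Poly_Mapping.lookup (squarefree_monomial W) v = (if v \<in> W then 1 else 0)"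
  by (simp add: squarefree_monomial_def lookup_sum lookup_single when_def)

lemma keys_squarefree_monomial: "finite W \<Longrightarrow> Poly_Mapping.keys (squarefree_monomial W) = W"
  by (auto simp: in_keys_iff lookup_squarefree_monomial split: if_splits)

lemma mdeg_squarefree_monomial: "finite W \<Longrightarrow> mdeg (squarefree_monomial W) = card W"
  by (simp add: mdeg_def keys_squarefree_monomial lookup_squarefree_monomial)

text \<open>The colon of the monomial of \<open>T\<close> by that of \<open>W\<close> is the
  monomial of \<open>T - W\<close>.\<close>

lemma mdvd_squarefree_monomial:
  assumes "finite T" "finite W"
  shows "mdvd (squarefree_monomial T) (m + squarefree_monomial W) \<longleftrightarrow> T - W \<subseteq> Poly_Mapping.keys m"
proof -
  have "mdvd (squarefree_monomial T) (m + squarefree_monomial W) \<longleftrightarrow>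
      (\<forall>v. (if v \<in> T then 1 else 0) \<le> Poly_Mapping.lookup m v + (if v \<in> W then 1 else 0))"
    using assms by (simp add: mdvd_def lookup_add lookup_squarefree_monomial)
  also have "\<dots> \<longleftrightarrow> (\<forall>v. v \<in> T \<longrightarrow> v \<notin> W \<longrightarrow> Poly_Mapping.lookup m v \<noteq> 0)"
    by (intro iff_allI) (simp add: Suc_le_eq)
  finally show ?thesis by (auto simp: in_keys_iff)
qed

lemma mdvd_variable: "mdvd (Poly_Mapping.single v 1) m \<longleftrightarrow> v \<in> Poly_Mapping.keys m"
  by (auto simp: mdvd_def lookup_single when_def in_keys_iff)

text \<open>Variables form a regular sequence: multiplication by a new variable \<open>x\<close>
  does not affect divisibility by the others, so the colon is the ideal already built.\<close>

lemma linear_module_variables: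
  fixes V :: "'v set"
  assumes "finite X" "X \<subseteq> V"
  shows "linear_module V 1 (ideal_vecs (monomial_ideal V ((\<lambda>v. Poly_Mapping.single v 1) ` X)) ::
    (nat \<Rightarrow> ('v, 'k::field) mpoly) set)"
  using assms
proof (induction X)
  case empty
  have "(monomial_ideal V {} :: ('v, 'k) mpoly set) = {0}"
    by (auto simp: monomial_ideal_def)
  then have "(ideal_vecs (monomial_ideal V {}) :: (nat \<Rightarrow> ('v, 'k) mpoly) set) = {\<lambda>k. 0}"
    by (simp add: ideal_vecs_def)
  then show ?case using linear_module_zero by simp
next
  case (insert x X)
  let ?I = "monomial_ideal V ((\<lambda>v. Poly_Mapping.single v 1) ` X) :: ('v, 'k) mpoly set"
  let ?x = "Poly_Mapping.single x 1 :: 'v \<Rightarrow>\<^sub>0 nat"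
  have k: "Poly_Mapping.keys ?x \<subseteq> V" using insert.prems by simp
  have "v \<in> Poly_Mapping.keys (m + ?x) \<longleftrightarrow> v \<in> Poly_Mapping.keys m" if "v \<in> X" for v m
  proof -
    have "v \<noteq> x" using that insert.hyps by auto
    then show ?thesis by (simp add: in_keys_iff lookup_add lookup_single when_def)
  qed
  then have "(\<exists>u'\<in>(\<lambda>v. Poly_Mapping.single v 1) ` X. mdvd u' (m + ?x)) \<longleftrightarrow>
      (\<exists>u'\<in>(\<lambda>v. Poly_Mapping.single v 1) ` X. mdvd u' m)" for m
    by (simp add: mdvd_variable del: One_nat_def)
  then have "{p \<in> poly_ring V. p * Poly_Mapping.single ?x 1 \<in> ?I} = ?I"
    unfolding colon_monomial_ideal[OF k] unfolding monomial_ideal_def by simp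
  then have "linear_module V 1 (ideal_vecs {q + p * Poly_Mapping.single ?x 1 |q p. q \<in> ?I \<and> p \<in> poly_ring V})"
    using insert.IH insert.prems by (intro linear_module_add_generator single_poly_ring k) (auto simp: homogeneous_single)
  then show ?case
    unfolding image_insert monomial_ideal_insert[OF k] .
qed

text \<open>The set \<open>X\<close> consists of the vertices that can enter \<open>W\<close> by a
  single exchange; the exchange condition says that their variables generate the whole colon
  ideal.\<close>

lemma linear_module_linear_quotients:
  fixes V :: "'v set"
  assumes "linear_quotients F" "finite V" "\<And>W. W \<in> F \<Longrightarrow> W \<subseteq> V \<and> card W = d"
  shows "linear_module V (int d) (ideal_vecs (monomial_ideal V (squarefree_monomial ` F)) ::
    (nat \<Rightarrow> ('v, 'k::field) mpoly) set)"
  using assms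
proof (induction)
  case empty
  have "(monomial_ideal V {} :: ('v, 'k) mpoly set) = {0}"
    by (auto simp: monomial_ideal_def)
  then have "(ideal_vecs (monomial_ideal V {}) :: (nat \<Rightarrow> ('v, 'k) mpoly) set) = {\<lambda>k. 0}"
    by (simp add: ideal_vecs_def)
  then show ?case using linear_module_zero by simp
next
  case (insert F W)
  let ?I = "monomial_ideal V (squarefree_monomial ` F) :: ('v, 'k) mpoly set"
  let ?u = "squarefree_monomial W"
  have fin: "finite T" if "T \<in> insert W F" for T
    using insert.prems(1) insert.prems(2)[OF that] finite_subset[of T V] by simp
  have k: "Poly_Mapping.keys ?u \<subseteq> V" using insert.prems(2)[of W] fin[of W] by (simp add: keys_squarefree_monomial)
  define X where "X = {t \<in> V - W. \<exists>y\<in>W. insert t (W - {y}) \<in> F}"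
  have keys_iff: "(\<exists>T\<in>F. T - W \<subseteq> Poly_Mapping.keys m) \<longleftrightarrow> (\<exists>t\<in>X. t \<in> Poly_Mapping.keys m)" for m
  proof
    assume "\<exists>T\<in>F. T - W \<subseteq> Poly_Mapping.keys m"
    then obtain T where T: "T \<in> F" "T - W \<subseteq> Poly_Mapping.keys m" by auto
    from insert.hyps(2)[OF T(1)] obtain t y where t: "t \<in> T - W" "y \<in> W" "insert t (W - {y}) \<in> F" by blast
    moreover have "T \<subseteq> V" using insert.prems(2)[of T] T(1) by simp
    ultimately have "t \<in> X" unfolding X_def by blast
    then show "\<exists>t\<in>X. t \<in> Poly_Mapping.keys m" using t(1) T(2) by blast
  next
    assume "\<exists>t\<in>X. t \<in> Poly_Mapping.keys m"
    then obtain t y where "t \<in> Poly_Mapping.keys m" "insert t (W - {y}) \<in> F" unfolding X_def by auto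
    then show "\<exists>T\<in>F. T - W \<subseteq> Poly_Mapping.keys m" by (intro bexI[of _ "insert t (W - {y})"]) auto
  qed
  have "(\<exists>u'\<in>squarefree_monomial ` F. mdvd u' (m + ?u)) \<longleftrightarrow>
      (\<exists>u'\<in>(\<lambda>v. Poly_Mapping.single v 1) ` X. mdvd u' m)" for m
  proof -
    have "(\<exists>u'\<in>squarefree_monomial ` F. mdvd u' (m + ?u)) \<longleftrightarrow> (\<exists>T\<in>F. T - W \<subseteq> Poly_Mapping.keys m)"
      using fin by (auto simp: mdvd_squarefree_monomial)
    also have "\<dots> \<longleftrightarrow> (\<exists>t\<in>X. t \<in> Poly_Mapping.keys m)" by (rule keys_iff)
    finally show ?thesis by (simp add: mdvd_variable del: One_nat_def)
  qed
  then have "{p \<in> poly_ring V. p * Poly_Mapping.single ?u 1 \<in> ?I} =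
      monomial_ideal V ((\<lambda>v. Poly_Mapping.single v 1) ` X)"
    unfolding colon_monomial_ideal[OF k] unfolding monomial_ideal_def by simp
  moreover have "finite X" "X \<subseteq> V" using insert.prems(1) unfolding X_def by auto
  ultimately have colon: "linear_module V 1 (ideal_vecs {p \<in> poly_ring V. p * Poly_Mapping.single ?u 1 \<in> ?I})"
    using linear_module_variables by simp
  have hom: "homogeneous (int d) (Poly_Mapping.single ?u (1 :: 'k))"
    using insert.prems(2)[of W] fin[of W] by (simp add: homogeneous_single mdeg_squarefree_monomial)
  have "linear_module V (int d) (ideal_vecs ?I)"
    by (rule insert.IH) (use insert.prems in auto)
  from linear_module_add_generator[OF this single_poly_ring[OF k] hom colon]
  show ?case
    unfolding image_insert monomial_ideal_insert[OF k] .
qed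

text \<open>One unfolding of the coinductive predicate gives generators and a syzygy module of the
  same kind; dependent choice strings these together.\<close>

lemma linear_resolution_exists:
  fixes J :: "('v, 'k::field) mpoly set"
  assumes "linear_module V d (ideal_vecs J)"
  obtains L where "graded_free_resolution V J L"
    "\<And>i k. k < free_rank L i \<Longrightarrow> gen_degs L i ! k = int i + d"
proof -
  let ?P = "\<lambda>i (ng :: nat \<times> (nat \<Rightarrow> nat \<Rightarrow> ('v, 'k) mpoly)).
    generators V (if i = 0 then d else 1) (fst ng) (snd ng) \<and>
    linear_module V 1 (syzygies V (fst ng) (snd ng)) \<and>
    (i = 0 \<longrightarrow> ideal_vecs J = comb (fst ng) (snd ng) ` vecs V (fst ng))"
  let ?Q = "\<lambda>i (ng :: nat \<times> (nat \<Rightarrow> nat \<Rightarrow> ('v, 'k) mpoly)) (ng' :: nat \<times> (nat \<Rightarrow> nat \<Rightarrow> ('v, 'k) mpoly)).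
    syzygies V (fst ng) (snd ng) = comb (fst ng') (snd ng') ` vecs V (fst ng')"
  have "\<exists>f. \<forall>i :: nat. ?P i (f i) \<and> ?Q i (f i) (f (Suc i))"
  proof (rule dependent_nat_choice)
    show "\<exists>ng. ?P 0 ng"
    proof -
      from assms obtain n g where "ideal_vecs J = comb n g ` vecs V n" "generators V d n g"
        "linear_module V 1 (syzygies V n g)"
        by (cases rule: linear_module.cases) blast
      then show ?thesis by (intro exI[of _ "(n, g)"]) simp
    qed
    fix ng and i :: nat assume "?P i ng"
    then have "linear_module V 1 (syzygies V (fst ng) (snd ng))" by blast
    then obtain n g where "syzygies V (fst ng) (snd ng) = comb n g ` vecs V n" "generators V 1 n g"
        "linear_module V 1 (syzygies V n g)"
      by (cases rule: linear_module.cases) blast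
    then show "\<exists>ng'. ?P (Suc i) ng' \<and> ?Q i ng ng'"
      by (intro exI[of _ "(n, g)"]) simp
  qed
  then obtain f where f: "\<forall>i. ?P i (f i) \<and> ?Q i (f i) (f (Suc i))" by (rule exE)
  define n where "n = (\<lambda>i. fst (f i))"
  define g where "g = (\<lambda>i. snd (f i))"
  have gen: "generators V (if i = 0 then d else 1) (n i) (g i)"
    and syz: "syzygies V (n i) (g i) = comb (n (Suc i)) (g (Suc i)) ` vecs V (n (Suc i))" for i
    using f unfolding n_def g_def by blast+
  have J: "ideal_vecs J = comb (n 0) (g 0) ` vecs V (n 0)"
    using f unfolding n_def g_def by blast
  \<comment> \<open>The first generators have degree \<open>d\<close> and each later matrix is
    linear, whence the degree \<open>int i + d\<close>. The vector \<open>g (Suc i) l\<close> is the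
    column \<open>l\<close>, so the indices are swapped.\<close>
  define L :: "('v, 'k) free_complex" where
    "L = \<lparr>gen_degs = (\<lambda>i. replicate (n i) (int i + d)), dmat = (\<lambda>i k l. g (Suc i) l k), aug = (\<lambda>l. g 0 l 0)\<rparr>"
  have rank: "free_rank L i = n i" for i by (simp add: free_rank_def L_def)
  have module: "free_module V L i = vecs V (n i)" for i
  proof -
    have "x k \<in> poly_ring V" if "\<forall>k<n i. x k \<in> poly_ring V" "\<forall>k\<ge>n i. x k = 0"
      for x :: "nat \<Rightarrow> ('v, 'k) mpoly" and k
      using that by (cases "k < n i") auto
    then show ?thesis unfolding free_module_def vecs_def rank by blast
  qed
  have aug: "aug_map L x = comb (n 0) (g 0) x 0" for x
    unfolding aug_map_def rank by (simp add: L_def comb_def mult.commute)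
  \<comment> \<open>These combinations lie in \<open>ideal_vecs J\<close>, so coordinate 0, which is
    all that the augmentation sees, determines them.\<close>
  have comb0: "comb (n 0) (g 0) x = (\<lambda>k. 0) \<longleftrightarrow> comb (n 0) (g 0) x 0 = 0" if "x \<in> vecs V (n 0)" for x
  proof -
    have "comb (n 0) (g 0) x \<in> ideal_vecs J" unfolding J using that by blast
    then show ?thesis by (auto simp: ideal_vecs_def fun_eq_iff)
  qed
  have diff: "diff_map L i x = comb (n (Suc i)) (g (Suc i)) x" if "x \<in> vecs V (n (Suc i))" for i x
  proof -
    have "comb (n (Suc i)) (g (Suc i)) x \<in> vecs V (n i)"
      using that syz[of i] by (auto simp: syzygies_def)
    then show ?thesis
      unfolding diff_map_def rank by (auto simp: L_def comb_def vecs_def mult.commute fun_eq_iff)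
  qed
  have image: "diff_map L i ` vecs V (n (Suc i)) = syzygies V (n i) (g i)" for i
    unfolding syz by (rule image_cong[OF refl diff])
  have "graded_free_resolution V J L"
    unfolding graded_free_resolution_def module aug rank
  proof (intro conjI allI impI)
    fix l assume "l < n 0"
    then show "aug L l \<in> poly_ring V" "homogeneous (gen_degs L 0 ! l) (aug L l)"
      using gen[of 0] by (auto simp: L_def generators_def)
  next
    fix i k l assume "k < n i" "l < n (Suc i)"
    then show "dmat L i k l \<in> poly_ring V" "homogeneous (gen_degs L (Suc i) ! l - gen_degs L i ! k) (dmat L i k l)"
      using gen[of "Suc i"] by (auto simp: L_def generators_def)
  next
    have "(\<lambda>x. comb (n 0) (g 0) x 0) ` vecs V (n 0) = (\<lambda>x. x 0) ` ideal_vecs J"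
      unfolding J by (simp add: image_image)
    also have "\<dots> = J" by (simp add: ideal_vecs_def image_image)
    finally show "(\<lambda>x. comb (n 0) (g 0) x 0) ` vecs V (n 0) = J" .
  next
    have "{x \<in> vecs V (n 0). comb (n 0) (g 0) x 0 = 0} = syzygies V (n 0) (g 0)"
      using comb0 by (auto simp: syzygies_def)
    then show "{x \<in> vecs V (n 0). comb (n 0) (g 0) x 0 = 0} = diff_map L 0 ` vecs V (n 1)"
      using image[of 0] by simp
  next
    fix i
    have "{x \<in> vecs V (n (Suc i)). diff_map L i x = (\<lambda>k. 0)} = syzygies V (n (Suc i)) (g (Suc i))"
      using diff by (auto simp: syzygies_def)
    then show "{x \<in> vecs V (n (Suc i)). diff_map L i x = (\<lambda>k. 0)} = diff_map L (Suc i) ` vecs V (n (Suc (Suc i)))"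
      using image[of "Suc i"] by simp
  qed
  moreover have "gen_degs L i ! k = int i + d" if "k < free_rank L i" for i k
    using that unfolding rank by (simp add: L_def)
  ultimately show thesis using that by blast
qed

text \<open>The linear resolution \<open>L\<close> serves twice: it shows that the choice in
  \<open>graded_Tor\<close> is a resolution, and it is what the chosen one is compared with.\<close>

lemma has_linear_resolution_linear_module:
  assumes "monomial_ideal_in_degree V d J" "linear_module V (int d) (ideal_vecs J)"
  shows "has_linear_resolution V d J"
proof -
  from linear_resolution_exists[OF assms(2)] obtain L where L: "graded_free_resolution V J L"
    "\<And>i k. k < free_rank L i \<Longrightarrow> gen_degs L i ! k = int (i + d)" by (metis of_nat_add)
  have "graded_free_resolution V J (SOME F. graded_free_resolution V J F)"
    by (rule someI[of _ L]) (rule L)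
  then show ?thesis
    using assms(1) is_singleton_tensor_homology[OF _ L] unfolding has_linear_resolution_def graded_Tor_def
    by blast
qed

section \<open>The 4-path ideal\<close>

lemma var_product:
  assumes "distinct [x1, x2, x3, x4]"
  shows "var x1 * var x2 * var x3 * var x4 = Poly_Mapping.single (squarefree_monomial {x1, x2, x3, x4}) (1 :: 'k::field)"
  using assms by (simp add: var_def mult_single squarefree_monomial_def add.assoc)

lemma gap_cricket_free_graph_edges:
  fixes V :: "'v set" and E :: "'v set set"
  assumes G: "simple_graph V E" and gap: "gap_free E" and cricket: "cricket_free V E"
  shows "gap_cricket_free_graph (\<lambda>u v. {u, v} \<in> E)"
proof
  fix a b c d w p q :: 'v
  show "{b, a} \<in> E" if "{a, b} \<in> E" using that by (simp add: insert_commute)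
  show irr: "{a, a} \<notin> E" for a using G by (auto simp: simple_graph_def)
  show "{a, c} \<in> E \<or> {a, d} \<in> E \<or> {b, c} \<in> E \<or> {b, d} \<in> E" if e: "{a, b} \<in> E" "{c, d} \<in> E"
  proof (rule ccontr)
    assume no: "\<not> ?thesis"
    then have "{a, b} \<inter> {c, d} = {}" using e by (auto simp: insert_commute)
    then show False using gap e no unfolding gap_free_def by blast
  qed
  show "{a, b} \<in> E \<or> {a, p} \<in> E \<or> {a, q} \<in> E \<or> {b, p} \<in> E \<or> {b, q} \<in> E"
    if e: "{w, p} \<in> E" "{w, q} \<in> E" "{p, q} \<in> E" "{w, a} \<in> E" "{w, b} \<in> E" "a \<noteq> b"
  proof (rule ccontr)
    assume no: "\<not> ?thesis"
    \<comment> \<open>The numbering of the model cricket: 3 is the centre, 4 and 5 complete the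
      triangle, 1 and 2 are pendant. Coincidences such as \<open>a = p\<close> are excluded because
      \<open>{p, q}\<close> would become an edge assumed absent.\<close>
    define f :: "nat \<Rightarrow> 'v" where
      "f = (\<lambda>n. if n = 1 then a else if n = 2 then b else if n = 3 then w else if n = 4 then p else q)"
    have ne: "w \<noteq> p" "w \<noteq> q" "p \<noteq> q" "w \<noteq> a" "w \<noteq> b" "a \<noteq> p" "a \<noteq> q" "b \<noteq> p" "b \<noteq> q"
      using e no irr by (auto simp: insert_commute)
    have "f ` cricket_vertices = {a, b, w, p, q}"
      by (auto simp: cricket_vertices_def f_def)
    moreover have "inj_on f cricket_vertices"
      unfolding cricket_vertices_def inj_on_def f_def using ne e(6) by simp
    ultimately have "bij_betw f cricket_vertices {a, b, w, p, q}" by (simp add: bij_betw_def)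
    moreover have "\<forall>u\<in>cricket_vertices. \<forall>v\<in>cricket_vertices.
        {u, v} \<in> cricket_edges \<longleftrightarrow> {f u, f v} \<in> induced_edges E {a, b, w, p, q}"
      using e no irr
      by (simp add: cricket_vertices_def cricket_edges_def induced_edges_def f_def doubleton_eq_iff insert_commute)
    moreover have "{a, b, w, p, q} \<subseteq> V" using G e unfolding simple_graph_def by blast
    ultimately show False using cricket unfolding cricket_free_def graph_isomorphic_def by blast
  qed
qed

theorem theorem3p7:
  fixes V :: "'v set" and E :: "'v set set"
  assumes "simple_graph V E"
    and "gap_free E"
    and "cricket_free V E"
  shows "has_linear_resolution V 4 (path_ideal4 V E :: ('v, 'k::field) mpoly set)"
proof -
  interpret gap_cricket_free_graph "\<lambda>u v. {u, v} \<in> E"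
    by (rule gap_cricket_free_graph_edges[OF assms])
  have V: "finite V" using assms(1) by (simp add: simple_graph_def)
  let ?F = "paths {} V {}"
  have F: "W \<subseteq> V" "card W = 4" "finite W" if "W \<in> ?F" for W
    using that card_path4 finite_path4 by (auto simp: paths_def)
  have "{var x1 * var x2 * var x3 * var x4 |x1 x2 x3 x4.
        x1 \<in> V \<and> x2 \<in> V \<and> x3 \<in> V \<and> x4 \<in> V \<and> distinct [x1, x2, x3, x4] \<and>
        {x1, x2} \<in> E \<and> {x2, x3} \<in> E \<and> {x3, x4} \<in> E} =
      (\<lambda>u. Poly_Mapping.single u (1 :: 'k)) ` squarefree_monomial ` ?F" (is "?A = ?B")
  proof
    show "?A \<subseteq> ?B"
    proof
      fix y :: "('v, 'k) mpoly" assume "y \<in> ?A"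
      then obtain x1 x2 x3 x4 where x: "y = var x1 * var x2 * var x3 * var x4"
          "{x1, x2, x3, x4} \<subseteq> V" "distinct [x1, x2, x3, x4]" "{x1, x2} \<in> E" "{x2, x3} \<in> E" "{x3, x4} \<in> E"
        by blast
      then have "{x1, x2, x3, x4} \<in> ?F" unfolding paths_def path4_def covers_def by blast
      then show "y \<in> ?B" using x(1) var_product[OF x(3)] by blast
    qed
    show "?B \<subseteq> ?A"
    proof
      fix y :: "('v, 'k) mpoly" assume "y \<in> ?B"
      then obtain W where W: "y = Poly_Mapping.single (squarefree_monomial W) 1" "W \<subseteq> V" "path4 W"
        by (auto simp: paths_def)
      from path4E[OF W(3)] obtain x1 x2 x3 x4 where x: "distinct [x1, x2, x3, x4]" "W = {x1, x2, x3, x4}"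
        "{x1, x2} \<in> E" "{x2, x3} \<in> E" "{x3, x4} \<in> E" by metis
      have "y = var x1 * var x2 * var x3 * var x4"
        unfolding W(1) x(2) by (rule var_product[OF x(1), symmetric])
      then show "y \<in> ?A" using x W(2) by blast
    qed
  qed
  then have J: "path_ideal4 V E =
      ideal_generated V ((\<lambda>u. Poly_Mapping.single u (1 :: 'k)) ` squarefree_monomial ` ?F)"
    by (simp add: path_ideal4_def)
  have gens: "\<forall>u\<in>squarefree_monomial ` ?F. Poly_Mapping.keys u \<subseteq> V \<and> mdeg u = 4"
    using F by (simp add: keys_squarefree_monomial mdeg_squarefree_monomial)
  show ?thesis
  proof (rule has_linear_resolution_linear_module)
    show "monomial_ideal_in_degree V 4 (path_ideal4 V E :: ('v, 'k) mpoly set)"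
      unfolding monomial_ideal_in_degree_def J using gens by blast
    have "linear_module V (int 4) (ideal_vecs (monomial_ideal V (squarefree_monomial ` ?F)) ::
        (nat \<Rightarrow> ('v, 'k) mpoly) set)"
      using linear_module_linear_quotients[OF linear_quotients_paths[OF V] V] F by blast
    moreover have "path_ideal4 V E = (monomial_ideal V (squarefree_monomial ` ?F) :: ('v, 'k) mpoly set)"
      unfolding J using gens by (intro ideal_generated_monomials) blast
    ultimately show "linear_module V (int 4) (ideal_vecs (path_ideal4 V E :: ('v, 'k) mpoly set))"
      by simp
  qed
qed

end
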